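(* Let $(\xi_i)_{i\in\mathbb N}$ be i.i.d. $N(0,1)$-distributed, and let $X=(X_n)_{n\in\mathbb N_0}$ be the random walk $X_n=\sum_{i=1}^n\xi_i$, $X_0:=0$. Let $\overline\sigma_n>0$ be deterministic constants, let $(\varepsilon_n)_n$ be i.i.d. $N(0,1)$-distributed and independent of $X$, and define the processes $\underline X^*=(\underline X_n^* )_{n\in\mathbb N_0}$ and $\overline X^*=(\overline X_n^* )_{n\in\mathbb N_0}$ by $$\underline X_n^*:=X_n\qquad\text{and}\qquad\overline X_n^*:=X_n+\overline\sigma_n\varepsilon_n .$$ For $n\in\mathbb N$ let $$\mathcal F_n:=\{F\text{ continuous distribution function}\mid F_{N(0,n)}(t)\ge F(t)\ge F_{N(0,n+\overline\sigma_n^2)}(t)\ \ \forall t\ge0\},$$ $$\mathcal C_n:=\{C\text{ bivariate copula}\mid C\text{ is SI and }C\geq_{lo}C^{\mathrm{Ga}}_{\underline\rho_n}\},\qquad\underline\rho_n:=\sqrt{n/(n+\overline\sigma_n^2)}.$$ Then, for any hidden Markov model $(X,X^* )=(X_n,X_n^* )_{n\in\mathbb N_0}$ specified by the random walk $X$ as hidden process and by $F_{X_n^*}\in\mathcal F_n$ and $C_{X_n,X_n^*}\in\mathcal C_n$ for all $n\in\mathbb N$, we have (for $d\in\mathbb N$) $$\max_{0\le n\le d}\{\underline X_n^*\}\leq_{st}\max_{0\le n\le d}\{X_n^*\}\leq_{st}\max_{0\le n\le d}\{\overline X_n^*\}.$$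
   Context: $F_{N(0,v)}$ is the distribution function of the centered normal distribution with variance $v$. $F_{X_n^*}$ is the distribution function of $X_n^*$ and $C_{X_n,X_n^*}$ is the copula of $(X_n,X_n^* )$, i.e. $P(X_n\le x,X_n^*\le y)=C_{X_n,X_n^*}(F_{X_n}(x),F_{X_n^*}(y))$. $C_\rho^{\mathrm{Ga}}$ is the bivariate Gaussian copula with correlation parameter $\rho$. $F_{N(0,n)}$ is the distribution function of $\underline X_n^*$, $F_{N(0,n+\overline\sigma_n^2)}$ that of $\overline X_n^*$, and $C^{\mathrm{Ga}}_{\underline\rho_n}$ is the copula of $(X_n,\overline X_n^* )$. $C\geq_{lo}D$ means $C(u,v)\ge D(u,v)$ for all $(u,v)\in[0,1]^2$. A bivariate copula $C$ is SI if for $(U,V)$ with distribution function $C$ the variable $V$ is stochastically increasing in $U$, i.e. $\mathbb E[f(V)\mid U=u]$ is increasing (non-decreasing) in $u$ outside a $P^U$-null set, for all increasing $f$ such that the expectations exist. $S\leq_{st}T$ means $\mathbb E\varphi(S)\le\mathbb E\varphi(T)$ for all increasing $\varphi$ such that the expectations exist. A hidden Markov model $(X,X^* )$ is a pair of real-valued processes with a representation $X_n=f_n(X_{n-1},\delta_n)$ a.s. for $n\in\mathbb N$ and $X_n^*=f_n^*(X_n,\varepsilon_n')$ a.s. for $n\in\mathbb N_0$, with measurable $f_n,f_n^*:\mathbb R^2\to\mathbb R$ and i.i.d. uniform on $[0,1]$ random variables $(\delta_n)_{n\in\mathbb N}$, $(\varepsilon_n')_{n\in\mathbb N_0}$ independent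 of $X_0$.
   Formalization: The formal statement takes $\overline\sigma_0=0$ (with $\overline\sigma_n>0$ only for $n\ge1$) and assumes $X_0^*=0$ almost surely; without this convention at time 0 the claimed chain of inequalities already fails for $d=1$. *)

theory Defs
  imports "HOL-Probability.Probability"
begin

definition normal_law :: "real \<Rightarrow> real measure" where
  "normal_law v = density lborel (\<lambda>x. ennreal (normal_density 0 (sqrt v) x))"

definition uniform_law :: "real measure" where
  "uniform_law = uniform_measure lborel {0..1}"

definition iid :: "'a measure \<Rightarrow> real measure \<Rightarrow> ('i \<Rightarrow> 'a \<Rightarrow> real) \<Rightarrow> 'i set \<Rightarrow> bool" where
  "iid M D Z I \<longleftrightarrow>
     prob_space.indep_vars M (\<lambda>_. borel) Z I \<and> (\<forall>i\<in>I. distr M borel (Z i) = D)"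

text \<open>
  The library's \<open>indep_var\<close> needs both variables to have the same value type; this is the version
  for a real-valued and a sequence-valued variable.
\<close>

definition indep_pair ::
    "'a measure \<Rightarrow> 'b measure \<Rightarrow> ('a \<Rightarrow> 'b) \<Rightarrow> 'c measure \<Rightarrow> ('a \<Rightarrow> 'c) \<Rightarrow> bool" where
  "indep_pair M A X B Y \<longleftrightarrow>
     X \<in> measurable M A \<and> Y \<in> measurable M B \<and>
     prob_space.indep_set M
       {X -` S \<inter> space M | S. S \<in> sets A} {Y -` S \<inter> space M | S. S \<in> sets B}"

definition st_le :: "'a measure \<Rightarrow> ('a \<Rightarrow> real) \<Rightarrow> ('a \<Rightarrow> real) \<Rightarrow> bool" where
  "st_le M S T \<longleftrightarrow>
     (\<forall>\<phi> :: real \<Rightarrow> real. mono \<phi> \<longrightarrow>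
        integrable M (\<lambda>\<omega>. \<phi> (S \<omega>)) \<longrightarrow> integrable M (\<lambda>\<omega>. \<phi> (T \<omega>)) \<longrightarrow>
        (\<integral>\<omega>. \<phi> (S \<omega>) \<partial>M) \<le> (\<integral>\<omega>. \<phi> (T \<omega>) \<partial>M))"

text \<open>
  The function \<open>g\<close> is a version of \<open>u \<mapsto> E[f(V) | U = u]\<close>, that is, a factorization through
  \<open>U\<close> of the conditional expectation given the sigma-algebra generated by \<open>U\<close>. Two versions agree
  outside a null set of the law of \<open>U\<close>, so the choice of \<open>g\<close> does not matter.
\<close>

definition stochastically_increasing ::
    "'a measure \<Rightarrow> ('a \<Rightarrow> real) \<Rightarrow> ('a \<Rightarrow> real) \<Rightarrow> bool" where
  "stochastically_increasing M U V \<longleftrightarrow>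
     (\<forall>f :: real \<Rightarrow> real. mono f \<longrightarrow> integrable M (\<lambda>\<omega>. f (V \<omega>)) \<longrightarrow>
        (\<exists>g \<in> borel_measurable borel.
           (AE \<omega> in M.
              real_cond_exp M (vimage_algebra (space M) U borel) (\<lambda>\<omega>. f (V \<omega>)) \<omega> = g (U \<omega>)) \<and>
           (\<exists>N \<in> null_sets (distr M borel U). mono_on (- N) g)))"

text \<open>
  A bivariate copula is the restriction to the unit square of a distribution function with uniform
  margins. It is represented by a curried function, whose values off the unit square are
  irrelevant. The measure \<open>\<mu>\<close> below is the joint law of a pair \<open>(U, V)\<close> with distribution
  function \<open>C\<close>; such a measure is determined by \<open>C\<close>.
\<close>

definition copula_law :: "(real \<times> real) measure \<Rightarrow> (real \<Rightarrow> real \<Rightarrow> real) \<Rightarrow> bool" where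
  "copula_law \<mu> C \<longleftrightarrow>
     prob_space \<mu> \<and> sets \<mu> = sets borel \<and>
     distr \<mu> borel fst = uniform_law \<and> distr \<mu> borel snd = uniform_law \<and>
     (\<forall>u\<in>{0..1}. \<forall>v\<in>{0..1}. measure \<mu> ({..u} \<times> {..v}) = C u v)"

definition copula :: "(real \<Rightarrow> real \<Rightarrow> real) \<Rightarrow> bool" where
  "copula C \<longleftrightarrow> (\<exists>\<mu>. copula_law \<mu> C)"

definition SI_copula :: "(real \<Rightarrow> real \<Rightarrow> real) \<Rightarrow> bool" where
  "SI_copula C \<longleftrightarrow> copula C \<and> (\<forall>\<mu>. copula_law \<mu> C \<longrightarrow> stochastically_increasing \<mu> fst snd)"

definition lo_ge :: "(real \<Rightarrow> real \<Rightarrow> real) \<Rightarrow> (real \<Rightarrow> real \<Rightarrow> real) \<Rightarrow> bool" where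
  "lo_ge C D \<longleftrightarrow> (\<forall>u\<in>{0..1}. \<forall>v\<in>{0..1}. C u v \<ge> D u v)"

definition copula_of ::
    "'a measure \<Rightarrow> ('a \<Rightarrow> real) \<Rightarrow> ('a \<Rightarrow> real) \<Rightarrow> (real \<Rightarrow> real \<Rightarrow> real) \<Rightarrow> bool" where
  "copula_of M X Y C \<longleftrightarrow>
     copula C \<and>
     (\<forall>x y. measure M {\<omega> \<in> space M. X \<omega> \<le> x \<and> Y \<omega> \<le> y} =
        C (cdf (distr M borel X) x) (cdf (distr M borel Y) y))"

text \<open>
  For \<open>\<bar>\<rho>\<bar> \<le> 1\<close> this is the distribution function of \<open>(\<Phi>(Z\<^sub>1), \<Phi>(Z\<^sub>2))\<close>, where \<open>\<Phi>\<close> is the standard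
  normal distribution function and \<open>(Z\<^sub>1, Z\<^sub>2)\<close> is bivariate normal with standard normal margins and
  correlation \<open>\<rho>\<close>, realized as \<open>Z\<^sub>1 = x\<close> and \<open>Z\<^sub>2 = \<rho> x + sqrt (1 - \<rho>\<^sup>2) y\<close> with \<open>x\<close>, \<open>y\<close>
  independent standard normal. This form avoids the quantile function of \<open>\<Phi>\<close> at 0 and 1.
\<close>

definition gaussian_copula :: "real \<Rightarrow> real \<Rightarrow> real \<Rightarrow> real" where
  "gaussian_copula \<rho> u v =
     measure (normal_law 1 \<Otimes>\<^sub>M normal_law 1)
       {(x, y). cdf (normal_law 1) x \<le> u \<and>
                cdf (normal_law 1) (\<rho> * x + sqrt (1 - \<rho>\<^sup>2) * y) \<le> v}"

definition F_class :: "nat \<Rightarrow> real \<Rightarrow> (real \<Rightarrow> real) set" where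
  "F_class n \<sigma> =
     {F. (\<exists>\<mu>. real_distribution \<mu> \<and> F = cdf \<mu>) \<and> continuous_on UNIV F \<and>
         (\<forall>t\<ge>0. cdf (normal_law (real n)) t \<ge> F t \<and> F t \<ge> cdf (normal_law (real n + \<sigma>\<^sup>2)) t)}"

definition C_class :: "nat \<Rightarrow> real \<Rightarrow> (real \<Rightarrow> real \<Rightarrow> real) set" where
  "C_class n \<sigma> =
     {C. SI_copula C \<and> lo_ge C (gaussian_copula (sqrt (real n / (real n + \<sigma>\<^sup>2))))}"

text \<open>
  The transition noises \<open>\<delta> n\<close>, \<open>n \<ge> 1\<close>, and the observation noises \<open>\<epsilon> n\<close>, \<open>n \<ge> 0\<close>, form one
  i.i.d. family, indexed by a disjoint sum, and this whole family is independent of \<open>X 0\<close>.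
\<close>

definition hidden_markov_model ::
    "'a measure \<Rightarrow> (nat \<Rightarrow> 'a \<Rightarrow> real) \<Rightarrow> (nat \<Rightarrow> 'a \<Rightarrow> real) \<Rightarrow> bool" where
  "hidden_markov_model M X Xs \<longleftrightarrow>
     (\<forall>n. X n \<in> borel_measurable M) \<and> (\<forall>n. Xs n \<in> borel_measurable M) \<and>
     (\<exists>(f :: nat \<Rightarrow> real \<times> real \<Rightarrow> real) (fs :: nat \<Rightarrow> real \<times> real \<Rightarrow> real)
        (\<delta> :: nat \<Rightarrow> 'a \<Rightarrow> real) (\<epsilon> :: nat \<Rightarrow> 'a \<Rightarrow> real).
        let I = Inl ` {1..} \<union> Inr ` UNIV; Z = case_sum \<delta> \<epsilon> in
          (\<forall>n\<ge>1. f n \<in> borel_measurable borel) \<and> (\<forall>n. fs n \<in> borel_measurable borel) \<and>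
          iid M uniform_law Z I \<and>
          indep_pair M borel (X 0)
            (Pi\<^sub>M I (\<lambda>_. borel)) (\<lambda>\<omega>. \<lambda>i\<in>I. Z i \<omega>) \<and>
          (\<forall>n\<ge>1. AE \<omega> in M. X n \<omega> = f n (X (n - 1) \<omega>, \<delta> n \<omega>)) \<and>
          (\<forall>n. AE \<omega> in M. Xs n \<omega> = fs n (X n \<omega>, \<epsilon> n \<omega>)))"

end

theory Submission
  imports Defs
begin

text \<open>
  As both maxima dominate the value 0 at time 0, only the events \<open>max \<le> t\<close> with \<open>t \<ge> 0\<close> matter. For
  observations \<open>X\<^sup>*\<close> of the walk \<open>X\<close> the probability of such an event is the expectation of
  \<open>\<Prod>n=1..d. K n (X n)\<close> with \<open>K n x = P(X\<^sup>* n \<le> t | X n = x)\<close>. This kernel is the indicator of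
  \<open>x \<le> t\<close> in the noiseless case and \<open>\<Phi>((t - x) / \<sigma> n)\<close> in the case of Gaussian noise. In general it
  is a density of \<open>x \<mapsto> C(F\<^sub>X x, F\<^sub>X\<^sub>* t)\<close> with respect to the law of \<open>X n\<close>, decreasing
  because \<open>C\<close> is SI, and the assumptions on copula and margin order the integrals of the
  three kernels over every half-line \<open>{..x}\<close>.

  The factors are exchanged one at a time, the last one first. The remaining factors contribute a
  decreasing weight of \<open>X k\<close>: the future through the independent increments, the past because
  \<open>X (k - 1)\<close> given \<open>X k = y\<close> is normal with a mean increasing in \<open>y\<close> and constant variance. Measures
  ordered on all half-lines \<open>{..x}\<close> are ordered on decreasing functions.
\<close>

subsection \<open>Measures ordered on half-lines\<close>

text \<open>Each value \<open>h x\<close> is the length of the set of nonnegative levels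
  \<open>s\<close> below it, and Tonelli exchanges the integral over levels with the integral over
  \<open>M\<close>. Comparing integrals is thereby reduced to comparing superlevel sets.\<close>

lemma nn_integral_layer_cake:
  fixes h :: "'a \<Rightarrow> ennreal"
  assumes "sigma_finite_measure M" and [measurable]: "h \<in> borel_measurable M"
  shows "(\<integral>\<^sup>+x. h x \<partial>M) =
    (\<integral>\<^sup>+s. emeasure M {x \<in> space M. ennreal s < h x} * indicator {0..} s \<partial>lborel)"
proof -
  interpret sigma_finite_measure M by fact
  interpret pair_sigma_finite M "lborel :: real measure" ..
  have layer: "r = (\<integral>\<^sup>+s. indicator {s. 0 \<le> s \<and> ennreal s < r} s \<partial>lborel)" for r :: ennreal
  proof (cases r)
    case (real q)
    then have "{s. 0 \<le> s \<and> ennreal s < r} = {0..<q}"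
      by (auto simp: ennreal_less_iff)
    with real show ?thesis by simp
  next
    case top
    then have "{s. 0 \<le> s \<and> ennreal s < r} = {0::real..}" by (auto simp: less_top)
    moreover have "emeasure lborel {0::real..} = \<infinity>"
    proof -
      have "ennreal (real n) \<le> emeasure lborel {0::real..}" for n
        using emeasure_mono[of "{0::real..real n}" "{0..}" lborel] by auto
      then show ?thesis
        using ennreal_SUP_of_nat_eq_top by (metis SUP_least ennreal_of_nat_eq_real_of_nat
            infinity_ennreal_def top.extremum_uniqueI)
    qed
    ultimately show ?thesis using top by simp
  qed
  have "(\<integral>\<^sup>+x. h x \<partial>M) = (\<integral>\<^sup>+x. \<integral>\<^sup>+s. indicator {s. 0 \<le> s \<and> ennreal s < h x} s \<partial>lborel \<partial>M)"
    by (intro nn_integral_cong layer)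
  also have "\<dots> = (\<integral>\<^sup>+s. \<integral>\<^sup>+x. indicator {s. 0 \<le> s \<and> ennreal s < h x} s \<partial>M \<partial>lborel)"
    by (rule Fubini'[symmetric]) simp
  also have "\<dots> = (\<integral>\<^sup>+s. emeasure M {x \<in> space M. ennreal s < h x} * indicator {0..} s \<partial>lborel)"
  proof (rule nn_integral_cong)
    fix s :: real
    have "(\<integral>\<^sup>+x. indicator {s. 0 \<le> s \<and> ennreal s < h x} s \<partial>M) =
        (\<integral>\<^sup>+x. indicator {0..} s * indicator {x \<in> space M. ennreal s < h x} x \<partial>M)"
      by (intro nn_integral_cong) (auto split: split_indicator)
    then show "(\<integral>\<^sup>+x. indicator {s. 0 \<le> s \<and> ennreal s < h x} s \<partial>M) =
        emeasure M {x \<in> space M. ennreal s < h x} * indicator {0..} s"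
      by (subst (asm) nn_integral_cmult) (auto simp: mult.commute)
  qed
  finally show ?thesis .
qed

text \<open>A downward closed set of reals is empty, the whole line, or a closed or open half-line.
  The line and the open half-lines are increasing unions of closed half-lines, so continuity from
  below carries the hypothesis over to them.\<close>

lemma emeasure_down_set_le:
  fixes M N :: "real measure"
  assumes sets: "sets M = sets borel" "sets N = sets borel"
    and le: "\<And>x. emeasure M {..x} \<le> emeasure N {..x}"
    and down: "\<And>x y. y \<in> D \<Longrightarrow> x \<le> y \<Longrightarrow> x \<in> D"
  shows "emeasure M D \<le> emeasure N D"
proof -
  have incseq_le: "emeasure M (\<Union>n. {..u n}) \<le> emeasure N (\<Union>n. {..u n})" if "incseq u" for u :: "nat \<Rightarrow> real"
  proof -
    have "incseq (\<lambda>n. {..u n})" using that by (auto simp: incseq_def intro: order_trans)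
    then have "emeasure K (\<Union>n. {..u n}) = (SUP n. emeasure K {..u n})" if "sets K = sets borel" for K
      by (rule SUP_emeasure_incseq[symmetric, rotated]) (simp add: that image_subset_iff)
    then show ?thesis using sets le by (simp add: SUP_mono')
  qed
  consider "D = {}" | "D = UNIV" | a where "a \<in> D" "D = {..a}" | a where "D = {..<a}"
  proof (cases "D = {} \<or> D = UNIV")
    case False
    then obtain b where b: "b \<notin> D" by auto
    have bdd: "bdd_above D" using b down by (intro bdd_aboveI[of _ b]) (meson linear)
    have less: "x \<in> D" if "x < Sup D" for x
      using that False down less_cSup_iff[OF _ bdd] by (metis less_imp_le)
    have upper: "x \<le> Sup D" if "x \<in> D" for x using that bdd by (rule cSup_upper)
    show ?thesis
    proof (cases "Sup D \<in> D")
      case True then have "D = {..Sup D}" using upper down by auto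
      with True show ?thesis by (rule that(3))
    next
      case False then have "D = {..<Sup D}" using upper less by (force simp: less_le)
      then show ?thesis by (rule that(4))
    qed
  qed (use that in auto)
  then show ?thesis
  proof cases
    case 1 then show ?thesis by simp
  next
    case 2
    have "(\<Union>n. {..real n}) = UNIV" by (auto simp: real_arch_simple)
    with 2 incseq_le[of real] show ?thesis by (auto simp: incseq_def)
  next
    case 3 with le show ?thesis by simp
  next
    case (4 a)
    have "(\<Union>n. {..a - 1 / real (Suc n)}) = {..<a}"
    proof safe
      fix x assume "x < a"
      then obtain n where "1 / real (Suc n) < a - x" using nat_approx_posE[of "a - x"] by auto
      then show "x \<in> (\<Union>n. {..a - 1 / real (Suc n)})" by (auto intro!: exI[of _ n])
    next
      fix x n assume "x \<le> a - 1 / real (Suc n)"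
      also have "\<dots> < a" by simp
      finally show "x < a" .
    qed
    moreover have "incseq (\<lambda>n. a - 1 / real (Suc n))"
      by (auto simp: incseq_def frac_le)
    ultimately show ?thesis using incseq_le 4 by metis
  qed
qed

text \<open>The superlevel sets of a decreasing function are downward closed, so the layer cake
  formula compares the two integrals level by level.\<close>

lemma nn_integral_antimono_le:
  fixes M N :: "real measure" and h :: "real \<Rightarrow> ennreal"
  assumes "sigma_finite_measure M" "sigma_finite_measure N"
    and sets: "sets M = sets borel" "sets N = sets borel"
    and le: "\<And>x. emeasure M {..x} \<le> emeasure N {..x}"
    and [measurable]: "h \<in> borel_measurable borel" and "antimono h"
  shows "(\<integral>\<^sup>+x. h x \<partial>M) \<le> (\<integral>\<^sup>+x. h x \<partial>N)"
proof -
  note [measurable_cong] = sets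
  have "emeasure M {x. ennreal s < h x} \<le> emeasure N {x. ennreal s < h x}" for s
    using sets le by (rule emeasure_down_set_le) (use \<open>antimono h\<close> in \<open>auto dest: antimonoD\<close>)
  moreover have "space M = UNIV" "space N = UNIV" using sets[THEN sets_eq_imp_space_eq] by auto
  ultimately show ?thesis
    using assms(1,2) by (simp add: nn_integral_layer_cake mult_right_mono nn_integral_mono)
qed

text \<open>Observation kernels serve as densities with respect to normal laws. Their bound 1 makes
  the resulting measures finite, hence sigma-finite as \<open>nn_integral_antimono_le\<close>
  demands.\<close>

lemma (in prob_space) finite_measure_density_le_1:
  assumes [measurable]: "K \<in> borel_measurable M" and le: "\<And>x. K x \<le> 1"
  shows "finite_measure (density M K)"
proof (rule finite_measureI)
  have "emeasure (density M K) (space M) = (\<integral>\<^sup>+x. K x \<partial>M)"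
    by (simp add: emeasure_density cong: nn_integral_cong)
  also have "\<dots> \<le> (\<integral>\<^sup>+x. 1 \<partial>M)" by (intro nn_integral_mono le)
  also have "\<dots> = 1" using emeasure_space_1 by simp
  finally show "emeasure (density M K) (space (density M K)) \<noteq> \<infinity>" by (auto simp: top_unique)
qed

section \<open>Stochastic order of random variables and of running maxima\<close>

lemma vimage_atMost_Int: "S -` {..x} \<inter> A = {\<omega> \<in> A. S \<omega> \<le> x}"
  by auto

text \<open>Cutting \<phi> off at height \<open>n\<close> makes \<open>n\<close> minus the cut
  function nonnegative and decreasing, which is what the comparison on half-lines handles. Dominated
  convergence then removes the cut.\<close>

lemma st_leI:
  assumes "prob_space M"
    and [measurable]: "S \<in> borel_measurable M" "T \<in> borel_measurable M"
    and le: "\<And>t. emeasure M {\<omega> \<in> space M. T \<omega> \<le> t} \<le> emeasure M {\<omega> \<in> space M. S \<omega> \<le> t}"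
  shows "st_le M S T"
  unfolding st_le_def
proof (intro allI impI)
  interpret prob_space M by fact
  fix \<phi> :: "real \<Rightarrow> real"
  assume "mono \<phi>" and S: "integrable M (\<lambda>\<omega>. \<phi> (S \<omega>))" and T: "integrable M (\<lambda>\<omega>. \<phi> (T \<omega>))"
  have [measurable]: "\<phi> \<in> borel_measurable borel" by (rule borel_measurable_mono) fact
  define trunc where "trunc n x = min (real n) (\<phi> x)" for n x
  have [measurable]: "trunc n \<in> borel_measurable borel" for n unfolding trunc_def by simp
  have trunc_mono: "trunc n x \<le> trunc n y" if "x \<le> y" for n x y
    unfolding trunc_def using monoD[OF \<open>mono \<phi>\<close> that] by linarith
  have int: "integrable M (\<lambda>\<omega>. trunc n (S \<omega>))" "integrable M (\<lambda>\<omega>. trunc n (T \<omega>))" for n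
    using S T unfolding trunc_def by simp_all
  have "(\<integral>\<omega>. trunc n (S \<omega>) \<partial>M) \<le> (\<integral>\<omega>. trunc n (T \<omega>) \<partial>M)" for n
  proof -
    have ds: "prob_space (distr M borel S)" "prob_space (distr M borel T)" by (auto intro!: prob_space_distr)
    have "(\<integral>\<^sup>+x. ennreal (real n - trunc n x) \<partial>distr M borel T) \<le>
        (\<integral>\<^sup>+x. ennreal (real n - trunc n x) \<partial>distr M borel S)"
    proof (rule nn_integral_antimono_le)
      show "antimono (\<lambda>x. ennreal (real n - trunc n x))"
        by (intro antimonoI ennreal_leI diff_left_mono trunc_mono)
      fix x show "emeasure (distr M borel T) {..x} \<le> emeasure (distr M borel S) {..x}"
        using le[of x] by (simp add: emeasure_distr vimage_atMost_Int)
    qed (use ds in \<open>auto intro: prob_space_imp_sigma_finite\<close>)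
    then have "(\<integral>\<^sup>+\<omega>. ennreal (real n - trunc n (T \<omega>)) \<partial>M) \<le> (\<integral>\<^sup>+\<omega>. ennreal (real n - trunc n (S \<omega>)) \<partial>M)"
      by (simp add: nn_integral_distr)
    moreover have "(\<integral>\<^sup>+\<omega>. ennreal (real n - trunc n (U \<omega>)) \<partial>M) = ennreal (\<integral>\<omega>. real n - trunc n (U \<omega>) \<partial>M)"
      if "integrable M (\<lambda>\<omega>. trunc n (U \<omega>))" for U
      using that by (intro nn_integral_eq_integral) (auto simp: trunc_def)
    moreover have "0 \<le> (\<integral>\<omega>. real n - trunc n (S \<omega>) \<partial>M)"
      by (intro integral_nonneg_AE) (auto simp: trunc_def)
    ultimately have "(\<integral>\<omega>. real n - trunc n (T \<omega>) \<partial>M) \<le> (\<integral>\<omega>. real n - trunc n (S \<omega>) \<partial>M)"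
      using int by (simp add: ennreal_le_iff)
    then show ?thesis using int by (simp add: prob_space)
  qed
  moreover have "(\<lambda>n. \<integral>\<omega>. trunc n (U \<omega>) \<partial>M) \<longlonglongrightarrow> (\<integral>\<omega>. \<phi> (U \<omega>) \<partial>M)"
    if U: "integrable M (\<lambda>\<omega>. \<phi> (U \<omega>))" and [measurable]: "U \<in> borel_measurable M" for U
  proof (rule integral_dominated_convergence)
    \<comment> \<open>The level \<open>real n\<close> is nonnegative, so cutting off from above
      never increases the absolute value.\<close>
    show "integrable M (\<lambda>\<omega>. \<bar>\<phi> (U \<omega>)\<bar>)" using U by simp
    have "(\<lambda>n. trunc n x) \<longlonglongrightarrow> \<phi> x" for x
    proof (rule tendsto_eventually)
      show "\<forall>\<^sub>F n in sequentially. trunc n x = \<phi> x"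
        unfolding trunc_def using eventually_ge_at_top[of "nat \<lceil>\<phi> x\<rceil>"]
        by eventually_elim linarith
    qed
    then show "AE \<omega> in M. (\<lambda>n. trunc n (U \<omega>)) \<longlonglongrightarrow> \<phi> (U \<omega>)" by simp
  qed (auto simp: trunc_def)
  ultimately show "(\<integral>\<omega>. \<phi> (S \<omega>) \<partial>M) \<le> (\<integral>\<omega>. \<phi> (T \<omega>) \<partial>M)"
    using S T by (intro LIMSEQ_le[of "\<lambda>n. \<integral>\<omega>. trunc n (S \<omega>) \<partial>M" _ "\<lambda>n. \<integral>\<omega>. trunc n (T \<omega>) \<partial>M"]) auto
qed

text \<open>The value 0 at time 0 makes both maxima nonnegative almost surely. For
  \<open>t < 0\<close> the event for \<open>T\<close> is therefore null, and for
  \<open>0 \<le> t\<close> time 0 imposes no constraint and only the times \<open>{1..d}\<close>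
  remain.\<close>

lemma st_le_MaxI:
  assumes "prob_space M" and [measurable]: "\<And>n. S n \<in> borel_measurable M" "\<And>n. T n \<in> borel_measurable M"
    and S0: "AE \<omega> in M. S 0 \<omega> = 0" and T0: "AE \<omega> in M. T 0 \<omega> = 0"
    and le: "\<And>t. 0 \<le> t \<Longrightarrow> emeasure M {\<omega> \<in> space M. \<forall>n\<in>{1..d}. T n \<omega> \<le> t} \<le>
      emeasure M {\<omega> \<in> space M. \<forall>n\<in>{1..d}. S n \<omega> \<le> t}"
  shows "st_le M (\<lambda>\<omega>. MAX n\<in>{0..d}. S n \<omega>) (\<lambda>\<omega>. MAX n\<in>{0..d::nat}. T n \<omega>)"
proof (rule st_leI[OF \<open>prob_space M\<close>])
  fix t :: real
  have nonneg: "emeasure M {\<omega> \<in> space M. (MAX n\<in>{0..d}. Y n \<omega>) \<le> t} = emeasure M {\<omega> \<in> space M. \<forall>n\<in>{1..d}. Y n \<omega> \<le> t}"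
    if "0 \<le> t" "AE \<omega> in M. Y 0 \<omega> = 0" and [measurable]: "\<And>n. Y n \<in> borel_measurable M"
    for Y :: "nat \<Rightarrow> 'a \<Rightarrow> real"
  proof (rule emeasure_eq_AE)
    have "{0..d} = insert 0 {1..d}" by auto
    with that show "AE \<omega> in M. \<omega> \<in> {\<omega> \<in> space M. (MAX n\<in>{0..d}. Y n \<omega>) \<le> t} \<longleftrightarrow> \<omega> \<in> {\<omega> \<in> space M. \<forall>n\<in>{1..d}. Y n \<omega> \<le> t}"
      by auto
  qed measurable
  show "emeasure M {\<omega> \<in> space M. (MAX n\<in>{0..d}. T n \<omega>) \<le> t} \<le> emeasure M {\<omega> \<in> space M. (MAX n\<in>{0..d}. S n \<omega>) \<le> t}"
  proof (cases "0 \<le> t")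
    case True
    then show ?thesis using nonneg[of S] nonneg[of T] S0 T0 le by simp
  next
    case False
    have "AE \<omega> in M. \<not> (MAX n\<in>{0..d}. T n \<omega>) \<le> t"
      using T0
    proof eventually_elim
      case (elim \<omega>)
      have "T 0 \<omega> \<le> (MAX n\<in>{0..d}. T n \<omega>)" by (intro Max_ge) auto
      with elim False show ?case by linarith
    qed
    then have "AE \<omega> in M. \<omega> \<in> {\<omega> \<in> space M. (MAX n\<in>{0..d}. T n \<omega>) \<le> t} \<longleftrightarrow> \<omega> \<in> {}"
      by eventually_elim blast
    then have "emeasure M {\<omega> \<in> space M. (MAX n\<in>{0..d}. T n \<omega>) \<le> t} = emeasure M {}"
      by (rule emeasure_eq_AE) simp_all
    then show ?thesis by simp
  qed
qed simp_all

subsection \<open>Normal laws and the Gaussian bridge\<close>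

lemma sets_normal_law [simp, measurable_cong]: "sets (normal_law v) = sets borel"
  by (simp add: normal_law_def)

lemma space_normal_law [simp]: "space (normal_law v) = UNIV"
  by (simp add: normal_law_def)

lemma prob_space_normal_law: "0 < v \<Longrightarrow> prob_space (normal_law v)"
  unfolding normal_law_def by (rule prob_space_normal_density) simp

lemma sigma_finite_normal_law: "0 < v \<Longrightarrow> sigma_finite_measure (normal_law v)"
  by (intro prob_space_imp_sigma_finite prob_space_normal_law)

lemma real_distribution_normal_law: "0 < v \<Longrightarrow> real_distribution (normal_law v)"
  by (simp add: real_distribution_def real_distribution_axioms_def prob_space_normal_law)

lemma nn_integral_normal_law:
  assumes [measurable]: "f \<in> borel_measurable borel"
  shows "(\<integral>\<^sup>+x. f x \<partial>normal_law v) = (\<integral>\<^sup>+x. ennreal (normal_density 0 (sqrt v) x) * f x \<partial>lborel)"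
  unfolding normal_law_def by (subst nn_integral_density) auto

lemma normal_density_scale:
  assumes "0 < v"
  shows "sqrt v * normal_density 0 (sqrt v) (sqrt v * z) = normal_density 0 1 z"
  using assms by (simp add: normal_density_def power_mult_distrib real_sqrt_mult)

lemma nn_integral_normal_law_scale:
  assumes "0 < v" and [measurable]: "f \<in> borel_measurable borel"
  shows "(\<integral>\<^sup>+x. f x \<partial>normal_law v) = (\<integral>\<^sup>+z. f (sqrt v * z) \<partial>normal_law 1)"
proof -
  have "(\<integral>\<^sup>+x. f x \<partial>normal_law v) =
      ennreal (sqrt v) * (\<integral>\<^sup>+z. ennreal (normal_density 0 (sqrt v) (sqrt v * z)) * f (sqrt v * z) \<partial>lborel)"
    using assms(1) unfolding nn_integral_normal_law[OF assms(2)]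
    by (subst nn_integral_real_affine[of _ "sqrt v" 0]) simp_all
  also have "\<dots> = (\<integral>\<^sup>+z. ennreal (sqrt v * normal_density 0 (sqrt v) (sqrt v * z)) * f (sqrt v * z) \<partial>lborel)"
    using assms by (simp add: nn_integral_cmult[symmetric] ennreal_mult mult.assoc)
  also have "\<dots> = (\<integral>\<^sup>+z. f (sqrt v * z) \<partial>normal_law 1)"
    using assms by (simp add: nn_integral_normal_law normal_density_scale)
  finally show ?thesis .
qed

text \<open>For independent centered normal variables with variances \<open>v\<close> and \<tau>,
  the first one given that the sum is \<open>y\<close> is normal with mean \<open>c * y\<close> and
  standard deviation \<open>s\<close>. The identity is this factorization of the joint density, with
  \<open>w\<close> the standardized first variable.\<close>

lemma normal_density_mult_bridge:
  assumes v: "0 < v" and \<tau>: "0 < \<tau>"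
  defines "c \<equiv> v / (v + \<tau>)" and "s \<equiv> sqrt (v * \<tau> / (v + \<tau>))"
  shows "s * (normal_density 0 (sqrt v) (c * y + s * w) * normal_density 0 (sqrt \<tau>) (y - (c * y + s * w))) =
    normal_density 0 (sqrt (v + \<tau>)) y * normal_density 0 1 w"
proof -
  have s: "0 < s" "s\<^sup>2 = v * \<tau> / (v + \<tau>)" using v \<tau> by (simp_all add: s_def)
  \<comment> \<open>The exponents match by completing the square: this \<open>c\<close> kills the
    mixed term in \<open>w * y\<close>, and this \<open>s\<close> normalizes the coefficient of the
    square of \<open>w\<close>.\<close>
  have "(c * y + s * w)\<^sup>2 / v + (y - (c * y + s * w))\<^sup>2 / \<tau> = y\<^sup>2 / (v + \<tau>) + w\<^sup>2"
  proof -
    have "(c * y + s * w)\<^sup>2 / v + (y - (c * y + s * w))\<^sup>2 / \<tau> =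
      y\<^sup>2 * (c\<^sup>2 / v + (1 - c)\<^sup>2 / \<tau>) + 2 * s * w * y * (c / v - (1 - c) / \<tau>) + w\<^sup>2 * (s\<^sup>2 * (1 / v + 1 / \<tau>))"
      using v \<tau> by (simp add: power2_eq_square field_simps)
    also have "1 - c = \<tau> / (v + \<tau>)" using v \<tau> by (simp add: c_def field_simps)
    also have "c\<^sup>2 / v + (\<tau> / (v + \<tau>))\<^sup>2 / \<tau> = (v + \<tau>) / (v + \<tau>)\<^sup>2"
      unfolding c_def using v \<tau> by (simp add: power_divide add_divide_distrib) (simp add: power2_eq_square)
    also have "\<dots> = 1 / (v + \<tau>)" using v \<tau> by (simp add: power2_eq_square)
    also have "c / v - \<tau> / (v + \<tau>) / \<tau> = 0" unfolding c_def using v \<tau> by simp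
    also have "s\<^sup>2 * (1 / v + 1 / \<tau>) = 1"
    proof -
      have "1 / v + 1 / \<tau> = (v + \<tau>) / (v * \<tau>)" using v \<tau> by (simp add: field_simps)
      then show ?thesis using v \<tau> s by simp
    qed
    finally show ?thesis by simp
  qed
  from arg_cong[OF this, of "\<lambda>r. - r / 2"]
  have "- (c * y + s * w)\<^sup>2 / v / 2 + - (y - (c * y + s * w))\<^sup>2 / \<tau> / 2 = - y\<^sup>2 / (v + \<tau>) / 2 + - w\<^sup>2 / 2"
    by (simp only: minus_divide_left add_divide_distrib minus_add_distrib)
  then have E: "exp (- (c * y + s * w)\<^sup>2 / (2 * v)) * exp (- (y - (c * y + s * w))\<^sup>2 / (2 * \<tau>)) =
      exp (- y\<^sup>2 / (2 * (v + \<tau>))) * exp (- w\<^sup>2 / 2)"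
    by (simp only: exp_add[symmetric] divide_divide_eq_left mult.commute[of _ 2])
  have P: "s * (1 / sqrt (2 * pi * v) * (1 / sqrt (2 * pi * \<tau>))) = 1 / sqrt (2 * pi * (v + \<tau>)) * (1 / sqrt (2 * pi))"
    using v \<tau> unfolding s_def by (simp only: real_sqrt_mult real_sqrt_divide) (simp add: field_simps)
  have density: "normal_density 0 (sqrt r) x = 1 / sqrt (2 * pi * r) * exp (- x\<^sup>2 / (2 * r))" if "0 < r" for r x
    using that by (simp add: normal_density_def)
  have "s * (normal_density 0 (sqrt v) (c * y + s * w) * normal_density 0 (sqrt \<tau>) (y - (c * y + s * w))) =
      s * (1 / sqrt (2 * pi * v) * (1 / sqrt (2 * pi * \<tau>))) *
      (exp (- (c * y + s * w)\<^sup>2 / (2 * v)) * exp (- (y - (c * y + s * w))\<^sup>2 / (2 * \<tau>)))"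
    unfolding density[OF v] density[OF \<tau>] by (simp only: mult.assoc mult.left_commute)
  also have "\<dots> = normal_density 0 (sqrt (v + \<tau>)) y * normal_density 0 1 w"
    unfolding E P density[OF add_pos_pos[OF v \<tau>]] std_normal_density_def
    by (simp only: mult.assoc mult.left_commute)
  finally show ?thesis .
qed

text \<open>The left side generates \<open>x\<close> first and then the sum
  \<open>y = x + z\<close>; the right side generates \<open>y\<close> first and then
  \<open>x\<close> given \<open>y\<close>. On the right \<open>y\<close> enters \<open>f\<close>
  only through a shift of the mean with a positive factor, which is how monotonicity in
  \<open>y\<close> will be seen.\<close>

lemma nn_integral_normal_bridge:
  assumes v: "0 < v" and \<tau>: "0 < \<tau>"
    and [measurable]: "f \<in> borel_measurable borel" "h \<in> borel_measurable borel"
  shows "(\<integral>\<^sup>+x. f x * (\<integral>\<^sup>+z. h (x + z) \<partial>normal_law \<tau>) \<partial>normal_law v) =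
    (\<integral>\<^sup>+y. (\<integral>\<^sup>+w. f (v / (v + \<tau>) * y + sqrt (v * \<tau> / (v + \<tau>)) * w) \<partial>normal_law 1) * h y \<partial>normal_law (v + \<tau>))"
proof -
  define c where "c = v / (v + \<tau>)"
  define s where "s = sqrt (v * \<tau> / (v + \<tau>))"
  have s: "0 < s" using v \<tau> by (simp add: s_def)
  let ?p = "\<lambda>v x. ennreal (normal_density 0 (sqrt v) x)"
  have "(\<integral>\<^sup>+x. f x * (\<integral>\<^sup>+z. h (x + z) \<partial>normal_law \<tau>) \<partial>normal_law v) =
      (\<integral>\<^sup>+x. ?p v x * (f x * (\<integral>\<^sup>+z. ?p \<tau> z * h (x + z) \<partial>lborel)) \<partial>lborel)"
    by (simp add: nn_integral_normal_law)
  also have "\<dots> = (\<integral>\<^sup>+x. ?p v x * (f x * (\<integral>\<^sup>+y. ?p \<tau> (y - x) * h y \<partial>lborel)) \<partial>lborel)"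
  proof -
    have "(\<integral>\<^sup>+y. ?p \<tau> (y - x) * h y \<partial>lborel) = (\<integral>\<^sup>+z. ?p \<tau> z * h (x + z) \<partial>lborel)" for x
      by (subst nn_integral_real_affine[of "\<lambda>y. ?p \<tau> (y - x) * h y" 1 x]) auto
    then show ?thesis by simp
  qed
  also have "\<dots> = (\<integral>\<^sup>+x. (\<integral>\<^sup>+y. ?p v x * ?p \<tau> (y - x) * f x * h y \<partial>lborel) \<partial>lborel)"
    by (simp add: nn_integral_cmult[symmetric] ac_simps)
  also have "\<dots> = (\<integral>\<^sup>+y. (\<integral>\<^sup>+x. ?p v x * ?p \<tau> (y - x) * f x * h y \<partial>lborel) \<partial>lborel)"
    by (rule lborel_pair.Fubini') simp
  \<comment> \<open>For fixed \<open>y\<close> the inner variable is standardized by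
    \<open>x = c * y + s * w\<close>, with Jacobian \<open>s\<close>.\<close>
  also have "\<dots> = (\<integral>\<^sup>+y. ennreal s * (\<integral>\<^sup>+w. ?p v (c * y + s * w) * ?p \<tau> (y - (c * y + s * w)) * f (c * y + s * w) * h y \<partial>lborel) \<partial>lborel)"
    using s by (intro nn_integral_cong) (subst nn_integral_real_affine[of _ s], auto)
  also have "\<dots> = (\<integral>\<^sup>+y. (\<integral>\<^sup>+w. ?p (v + \<tau>) y * ?p 1 w * f (c * y + s * w) * h y \<partial>lborel) \<partial>lborel)"
  proof (intro nn_integral_cong)
    fix y
    have "ennreal s * (?p v (c * y + s * w) * ?p \<tau> (y - (c * y + s * w)) * f (c * y + s * w) * h y) =
        ennreal (s * (normal_density 0 (sqrt v) (c * y + s * w) * normal_density 0 (sqrt \<tau>) (y - (c * y + s * w)))) *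
          f (c * y + s * w) * h y" for w
      using s by (simp add: ennreal_mult mult.assoc)
    moreover note normal_density_mult_bridge[OF v \<tau>, folded c_def s_def]
    ultimately have "ennreal s * (?p v (c * y + s * w) * ?p \<tau> (y - (c * y + s * w)) * f (c * y + s * w) * h y) =
        ?p (v + \<tau>) y * ?p 1 w * f (c * y + s * w) * h y" for w
      by (simp add: ennreal_mult)
    then show "ennreal s * (\<integral>\<^sup>+w. ?p v (c * y + s * w) * ?p \<tau> (y - (c * y + s * w)) * f (c * y + s * w) * h y \<partial>lborel) =
        (\<integral>\<^sup>+w. ?p (v + \<tau>) y * ?p 1 w * f (c * y + s * w) * h y \<partial>lborel)"
      by (simp add: nn_integral_cmult[symmetric])
  qed
  also have "\<dots> = (\<integral>\<^sup>+y. ?p (v + \<tau>) y * ((\<integral>\<^sup>+w. ?p 1 w * f (c * y + s * w) \<partial>lborel) * h y) \<partial>lborel)"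
    by (simp add: nn_integral_cmult[symmetric] nn_integral_multc[symmetric] mult.assoc)
  also have "\<dots> = (\<integral>\<^sup>+y. (\<integral>\<^sup>+w. f (c * y + s * w) \<partial>normal_law 1) * h y \<partial>normal_law (v + \<tau>))"
    by (simp add: nn_integral_normal_law)
  finally show ?thesis by (simp add: c_def s_def)
qed

subsection \<open>Distribution functions and copulas\<close>

lemma cdf_normal_law_scale:
  assumes "0 < v"
  shows "cdf (normal_law v) x = cdf (normal_law 1) (x / sqrt v)"
proof -
  have "emeasure (normal_law v) {..x} = emeasure (normal_law 1) {..x / sqrt v}"
  proof -
    have "indicator {..x} (sqrt v * z) = (indicator {..x / sqrt v} z :: ennreal)" for z
      using assms by (auto simp: indicator_def field_simps)
    then show ?thesis
      using nn_integral_normal_law_scale[OF assms, of "indicator {..x}"] by simp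
  qed
  then show ?thesis by (simp add: cdf_def measure_def)
qed

text \<open>The normal density is positive everywhere, so a nondegenerate interval cannot be null
  and the distribution function is strictly increasing. As a simplification rule this turns the
  events defining the Gaussian copula into linear inequalities.\<close>

lemma cdf_normal_law_le_iff [simp]:
  assumes "0 < v"
  shows "cdf (normal_law v) x \<le> cdf (normal_law v) y \<longleftrightarrow> x \<le> y"
proof -
  interpret real_distribution "normal_law v" using assms by (rule real_distribution_normal_law)
  have "cdf (normal_law v) y < cdf (normal_law v) x" if "y < x" for x y
  proof -
    have "emeasure (normal_law v) {y<..x} \<noteq> 0"
    proof
      assume "emeasure (normal_law v) {y<..x} = 0"
      then have "(\<integral>\<^sup>+z. ennreal (normal_density 0 (sqrt v) z) * indicator {y<..x} z \<partial>lborel) = 0"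
        by (simp add: normal_law_def emeasure_density)
      then have "AE z in lborel. ennreal (normal_density 0 (sqrt v) z) * indicator {y<..x} z = 0"
        by (subst (asm) nn_integral_0_iff_AE) auto
      then have "AE z in lborel. z \<notin> {y<..x}"
      proof eventually_elim
        case (elim z)
        then show ?case using normal_density_pos[of "sqrt v" 0 z] assms by (auto simp: ennreal_eq_0_iff indicator_def)
      qed
      then have "emeasure lborel {y<..x} = 0"
        by (subst (asm) AE_iff_measurable[of "{y<..x}"]) auto
      with that show False by simp
    qed
    then have "0 < measure (normal_law v) {y<..x}" by (simp add: emeasure_eq_measure zero_less_measure_iff)
    with cdf_diff_eq[OF that] show ?thesis by simp
  qed
  then show ?thesis using cdf_nondecreasing by (metis linorder_not_le)
qed

lemma isCont_cdf_normal_law: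
  assumes "0 < v"
  shows "isCont (cdf (normal_law v)) x"
proof -
  interpret real_distribution "normal_law v" using assms by (rule real_distribution_normal_law)
  have "{x} \<in> null_sets (normal_law v)"
  proof -
    have "AE y in lborel. y \<in> {x} \<longrightarrow> ennreal (normal_density 0 (sqrt v) y) = 0"
      using AE_lborel_singleton[of x] by eventually_elim simp
    then show ?thesis unfolding normal_law_def by (subst null_sets_density_iff) auto
  qed
  then show ?thesis by (simp add: isCont_cdf measure_def null_sets_def)
qed

section \<open>Probability integral transform\<close>

lemma cdf_uniform_law:
  assumes "u \<in> {0..1}"
  shows "cdf uniform_law u = u"
proof -
  have "{0..1} \<inter> {..u} = {0..u}" using assms by auto
  then have "emeasure uniform_law {..u} = ennreal u"
    unfolding uniform_law_def using assms by (subst emeasure_uniform_measure) (auto simp: divide_ennreal_def)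
  then show ?thesis using assms by (simp add: cdf_def measure_def)
qed

lemma real_distribution_uniform_law: "real_distribution uniform_law"
  unfolding real_distribution_def real_distribution_axioms_def uniform_law_def
  by (intro conjI prob_space_uniform_measure) auto

text \<open>A level \<open>u\<close> strictly between 0 and 1 is attained at some \<open>x\<close>
  by the intermediate value theorem, and strict monotonicity identifies the event that
  \<open>cdf M\<close> is at most \<open>u\<close> with \<open>{..x}\<close>. Strictness also keeps
  \<open>cdf M\<close> strictly between 0 and 1, which settles the other levels.\<close>

lemma distr_cdf_uniform:
  assumes "real_distribution M" and cont: "\<And>x. isCont (cdf M) x"
    and le_iff: "\<And>x y. cdf M x \<le> cdf M y \<longleftrightarrow> x \<le> y"
  shows "distr M borel (cdf M) = uniform_law"
proof -
  interpret real_distribution M by fact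
  interpret U: real_distribution uniform_law by (rule real_distribution_uniform_law)
  have [measurable]: "cdf M \<in> borel_measurable borel"
    using cdf_nondecreasing by (intro borel_measurable_mono) (auto simp: mono_def)
  interpret D: real_distribution "distr M borel (cdf M)"
    by (rule real_distribution_distr) simp
  have "cdf (distr M borel (cdf M)) u = cdf uniform_law u" for u
  proof -
    have eq: "cdf (distr M borel (cdf M)) u = measure M {x. cdf M x \<le> u}"
      unfolding cdf_def[of "distr M borel (cdf M)"] by (simp add: measure_distr vimage_def)
    have strict: "x < y \<Longrightarrow> cdf M x < cdf M y" for x y using le_iff by (meson linorder_not_le)
    have less_1: "cdf M x < 1" for x using strict[of x "x + 1"] cdf_bounded_prob[of "x + 1"] by simp
    have gr_0: "0 < cdf M x" for x using strict[of "x - 1" x] cdf_nonneg[of "x - 1"] by simp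
    consider "u \<le> 0" | "0 < u" "u < 1" | "1 \<le> u" by linarith
    then show ?thesis
    proof cases
      case 1
      have "{x. cdf M x \<le> u} = {}" using gr_0 1 by (auto simp: not_le intro: less_le_trans le_less_trans)
      moreover have "cdf uniform_law u = 0"
        using U.cdf_nondecreasing[OF 1] U.cdf_nonneg[of u] cdf_uniform_law[of 0] by simp
      ultimately show ?thesis using eq by simp
    next
      case 2
      obtain a where a: "cdf M a < u"
        using order_tendstoD(2)[OF cdf_lim_at_bot 2(1)] by (auto simp: eventually_at_bot_linorder)
      obtain b where b: "u < cdf M b"
        using order_tendstoD(1)[OF cdf_lim_at_top_prob 2(2)] by (auto simp: eventually_at_top_linorder)
      have "a \<le> b" using a b le_iff[of a b] by simp
      then obtain x where x: "cdf M x = u"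
        using IVT[of "cdf M" a u b] a b cont by auto
      then have "{y. cdf M y \<le> u} = {..x}" using le_iff by auto
      then have "cdf (distr M borel (cdf M)) u = u" using eq x by (simp add: cdf_def)
      then show ?thesis using 2 by (simp add: cdf_uniform_law)
    next
      case 3
      have "{x. cdf M x \<le> u} = UNIV" using less_1 3 by (auto intro: less_imp_le less_le_trans)
      moreover have "cdf uniform_law u = 1"
        using U.cdf_nondecreasing[OF 3] U.cdf_bounded_prob[of u] cdf_uniform_law[of 1] by simp
      ultimately show ?thesis using eq prob_space by simp
    qed
  qed
  then show ?thesis
    by (intro cdf_unique) (auto intro: D.real_distribution_axioms U.real_distribution_axioms)
qed

lemma distr_cdf_normal_law:
  "0 < v \<Longrightarrow> distr (normal_law v) borel (cdf (normal_law v)) = uniform_law"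
  by (intro distr_cdf_uniform real_distribution_normal_law isCont_cdf_normal_law cdf_normal_law_le_iff)

text \<open>The correlation is that of a hidden value \<open>sqrt v * a\<close> and its noisy
  observation \<open>sqrt v * a + \<sigma> * b\<close>. With their own margins inserted, the copula
  is the probability that the hidden value is at most \<open>x\<close> and the observation at most
  \<open>t\<close>; conditioning on the hidden value gives the integral.\<close>

lemma gaussian_copula_normal_cdf:
  assumes v: "0 < v" and \<sigma>: "0 < \<sigma>"
  shows "ennreal (gaussian_copula (sqrt (v / (v + \<sigma>\<^sup>2))) (cdf (normal_law v) x) (cdf (normal_law (v + \<sigma>\<^sup>2)) t)) =
    (\<integral>\<^sup>+y. emeasure (normal_law 1) {e. y + \<sigma> * e \<le> t} * indicator {..x} y \<partial>normal_law v)"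
proof -
  interpret N: prob_space "normal_law 1" by (simp add: prob_space_normal_law)
  interpret P: pair_prob_space "normal_law 1" "normal_law 1" ..
  define \<rho> where "\<rho> = sqrt (v / (v + \<sigma>\<^sup>2))"
  have pos: "0 < v + \<sigma>\<^sup>2" using v by (simp add: add_pos_nonneg)
  have "1 - \<rho>\<^sup>2 = \<sigma>\<^sup>2 / (v + \<sigma>\<^sup>2)" using v pos by (simp add: \<rho>_def field_simps)
  then have \<rho>': "sqrt (1 - \<rho>\<^sup>2) = \<sigma> / sqrt (v + \<sigma>\<^sup>2)" using \<sigma> by (simp add: real_sqrt_divide)
  \<comment> \<open>The second coordinate of the Gaussian copula is the observation divided by its
    standard deviation.\<close>
  have "\<rho> * a + sqrt (1 - \<rho>\<^sup>2) * b = (sqrt v * a + \<sigma> * b) / sqrt (v + \<sigma>\<^sup>2)" for a b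
    unfolding \<rho>' by (simp add: \<rho>_def real_sqrt_divide add_divide_distrib)
  then have "cdf (normal_law 1) (\<rho> * a + sqrt (1 - \<rho>\<^sup>2) * b) \<le> cdf (normal_law (v + \<sigma>\<^sup>2)) t \<longleftrightarrow>
      sqrt v * a + \<sigma> * b \<le> t" for a b
    using pos by (simp add: cdf_normal_law_scale[OF pos] divide_le_cancel)
  moreover have "cdf (normal_law 1) a \<le> cdf (normal_law v) x \<longleftrightarrow> sqrt v * a \<le> x" for a
    using v by (simp add: cdf_normal_law_scale[OF v] pos_le_divide_eq mult.commute)
  ultimately have "gaussian_copula \<rho> (cdf (normal_law v) x) (cdf (normal_law (v + \<sigma>\<^sup>2)) t) =
      measure (normal_law 1 \<Otimes>\<^sub>M normal_law 1) {(a, b). sqrt v * a \<le> x \<and> sqrt v * a + \<sigma> * b \<le> t}"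
    by (simp add: gaussian_copula_def)
  then have "ennreal (gaussian_copula \<rho> (cdf (normal_law v) x) (cdf (normal_law (v + \<sigma>\<^sup>2)) t)) =
      emeasure (normal_law 1 \<Otimes>\<^sub>M normal_law 1) {(a, b). sqrt v * a \<le> x \<and> sqrt v * a + \<sigma> * b \<le> t}"
    by (simp add: P.emeasure_eq_measure)
  also have "\<dots> = (\<integral>\<^sup>+a. emeasure (normal_law 1) (Pair a -` {(a, b). sqrt v * a \<le> x \<and> sqrt v * a + \<sigma> * b \<le> t}) \<partial>normal_law 1)"
  proof (rule N.emeasure_pair_measure_alt)
    have "Measurable.pred (normal_law 1 \<Otimes>\<^sub>M normal_law 1) (\<lambda>(a, b). sqrt v * a \<le> x \<and> sqrt v * a + \<sigma> * b \<le> t)"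
      by measurable
    then show "{(a, b). sqrt v * a \<le> x \<and> sqrt v * a + \<sigma> * b \<le> t} \<in> sets (normal_law 1 \<Otimes>\<^sub>M normal_law 1)"
      by (simp add: pred_def space_pair_measure)
  qed
  also have "\<dots> = (\<integral>\<^sup>+a. emeasure (normal_law 1) {e. sqrt v * a + \<sigma> * e \<le> t} * indicator {..x} (sqrt v * a) \<partial>normal_law 1)"
    by (intro nn_integral_cong) (auto simp: indicator_def vimage_def)
  also have "\<dots> = (\<integral>\<^sup>+y. emeasure (normal_law 1) {e. y + \<sigma> * e \<le> t} * indicator {..x} y \<partial>normal_law v)"
    by (rule nn_integral_normal_law_scale[OF v, symmetric]) measurable
  finally show ?thesis by (simp add: \<rho>_def)
qed

lemma gaussian_copula_mono:
  assumes "v \<le> v'"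
  shows "gaussian_copula \<rho> u v \<le> gaussian_copula \<rho> u v'"
proof -
  interpret N: real_distribution "normal_law 1" by (rule real_distribution_normal_law) simp
  interpret P: pair_prob_space "normal_law 1" "normal_law 1" ..
  have [measurable]: "cdf (normal_law 1) \<in> borel_measurable borel"
    using N.cdf_nondecreasing by (intro borel_measurable_mono) (auto simp: mono_def)
  have "Measurable.pred (normal_law 1 \<Otimes>\<^sub>M normal_law 1)
      (\<lambda>(x, y). cdf (normal_law 1) x \<le> u \<and> cdf (normal_law 1) (\<rho> * x + sqrt (1 - \<rho>\<^sup>2) * y) \<le> v')"
    by measurable
  then show ?thesis
    unfolding gaussian_copula_def using assms
    by (intro P.finite_measure_mono) (auto simp: pred_def space_pair_measure)
qed

text \<open>
  Monotonicity off a null set is upgraded to monotonicity everywhere by taking running suprema.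
\<close>

lemma mono_version:
  fixes g :: "real \<Rightarrow> real"
  assumes N: "N \<in> null_sets M" and mono: "mono_on (- N) g"
    and bounds: "AE x in M. 0 \<le> g x \<and> g x \<le> 1"
  shows "\<exists>g'. mono g' \<and> (\<forall>x. 0 \<le> g' x \<and> g' x \<le> 1) \<and> (AE x in M. g' x = g x)"
proof -
  \<comment> \<open>The bounds on \<open>g\<close> hold only almost everywhere, so values are
    clamped to the unit interval before suprema are taken. Inserting 0 in \<open>V x\<close> covers
    the case that all points up to \<open>x\<close> lie in \<open>N\<close>.\<close>
  define clamp where "clamp x = max 0 (min 1 (g x))" for x
  define V where "V x = insert 0 (clamp ` {y. y \<le> x \<and> y \<notin> N})" for x
  define g' where "g' x = Sup (V x)" for x
  have bdd: "bdd_above (V x)" for x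
    by (rule bdd_aboveI[of _ 1]) (auto simp: V_def clamp_def)
  have "mono g'"
    unfolding g'_def by (intro monoI cSup_subset_mono bdd) (auto simp: V_def)
  moreover have "0 \<le> g' x \<and> g' x \<le> 1" for x
    unfolding g'_def
    by (intro conjI cSup_upper cSup_least bdd) (auto simp: V_def clamp_def)
  moreover have "AE x in M. g' x = g x"
    using AE_not_in[OF N] bounds
  proof eventually_elim
    case (elim x)
    have "clamp y \<le> clamp x" if "y \<le> x" "y \<notin> N" for y
    proof -
      have "g y \<le> g x" using mono_onD[OF mono, of y x] that elim by auto
      then show ?thesis by (simp add: clamp_def)
    qed
    then have "Sup (V x) = clamp x"
      using elim(1) by (intro cSup_eq_maximum) (auto simp: V_def clamp_def)
    then show ?case using elim by (simp add: g'_def clamp_def)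
  qed
  ultimately show ?thesis by auto
qed

text \<open>The function \<open>k\<close> is a version of the conditional probability of
  \<open>V \<le> v\<close> given \<open>U = s\<close>. It is one minus the conditional expectation
  of the increasing indicator of \<open>{v<..}\<close>, which the SI property makes increasing off a
  null set and \<open>mono_version\<close> makes increasing everywhere.\<close>

lemma SI_copula_density:
  assumes SI: "SI_copula C" and v: "v \<in> {0..1}"
  shows "\<exists>k :: real \<Rightarrow> real. antimono k \<and> (\<forall>x. 0 \<le> k x \<and> k x \<le> 1) \<and>
    (\<forall>u\<in>{0..1}. ennreal (C u v) = (\<integral>\<^sup>+s. ennreal (k s) * indicator {..u} s \<partial>uniform_law))"
proof -
  obtain \<mu> where \<mu>: "copula_law \<mu> C" and "stochastically_increasing \<mu> fst snd"
    using SI by (auto simp: SI_copula_def copula_def)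
  then interpret prob_space \<mu> by (simp add: copula_law_def)
  have sets_\<mu> [measurable_cong]: "sets \<mu> = sets (borel :: (real \<times> real) measure)"
    and U: "distr \<mu> borel fst = uniform_law"
    and C: "\<And>u. u \<in> {0..1} \<Longrightarrow> prob ({..u} \<times> {..v}) = C u v"
    using \<mu> v by (auto simp: copula_law_def)
  have space_\<mu>: "space \<mu> = UNIV" using sets_eq_imp_space_eq[OF sets_\<mu>] by simp
  have fst_m [measurable]: "fst \<in> borel_measurable \<mu>" and [measurable]: "snd \<in> borel_measurable \<mu>"
    by (simp_all add: measurable_cong_sets[OF sets_\<mu> refl] flip: borel_prod)
  define f :: "real \<Rightarrow> real" where "f = indicator {v<..}"
  have "mono f" by (auto simp: f_def mono_def indicator_def)
  have [measurable]: "f \<in> borel_measurable borel" by (simp add: f_def)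
  have int_f: "integrable \<mu> (\<lambda>\<omega>. f (snd \<omega>))"
    by (rule integrable_const_bound[of _ 1]) (auto simp: f_def indicator_def)
  let ?F = "vimage_algebra (space \<mu>) fst (borel :: real measure)"
  obtain g N where [measurable]: "g \<in> borel_measurable borel"
    and g: "AE \<omega> in \<mu>. real_cond_exp \<mu> ?F (\<lambda>\<omega>. f (snd \<omega>)) \<omega> = g (fst \<omega>)"
    and N: "N \<in> null_sets uniform_law" "mono_on (- N) g"
    using \<open>stochastically_increasing \<mu> fst snd\<close> \<open>mono f\<close> int_f
    unfolding stochastically_increasing_def U by blast
  have "subalgebra \<mu> ?F"
    using measurable_sets[OF fst_m] by (auto simp: subalgebra_def sets_vimage_algebra2)
  then interpret F: finite_measure_subalgebra \<mu> ?F
    by unfold_locales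
  interpret F: sigma_finite_subalgebra \<mu> ?F
    by (rule finite_measure_subalgebra_is_sigma_finite) unfold_locales
  have "AE \<omega> in \<mu>. 0 \<le> g (fst \<omega>) \<and> g (fst \<omega>) \<le> 1"
    using F.real_cond_exp_ge_c[OF int_f, of 0] F.real_cond_exp_le_c[OF int_f, of 1] g
    by (auto simp: f_def indicator_def)
  then have "AE s in uniform_law. 0 \<le> g s \<and> g s \<le> 1"
    unfolding U[symmetric] by (subst AE_distr_iff) auto
  from mono_version[OF N this] obtain g' where "mono g'" and g'_bounds: "\<And>x. 0 \<le> g' x \<and> g' x \<le> 1"
    and g'_eq: "AE s in uniform_law. g' s = g s" by auto
  have [measurable]: "g' \<in> borel_measurable borel" using \<open>mono g'\<close> by (rule borel_measurable_mono)
  have "AE \<omega> in \<mu>. g' (fst \<omega>) = g (fst \<omega>)"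
    using g'_eq unfolding U[symmetric] by (subst (asm) AE_distr_iff) auto
  with g have cond_exp: "AE \<omega> in \<mu>. real_cond_exp \<mu> ?F (\<lambda>\<omega>. f (snd \<omega>)) \<omega> = g' (fst \<omega>)"
    by auto
  have int_g': "integrable \<mu> (\<lambda>\<omega>. g' (fst \<omega>))"
    by (rule integrable_const_bound[of _ 1]) (use g'_bounds in auto)
  have "ennreal (C u v) = (\<integral>\<^sup>+s. ennreal (1 - g' s) * indicator {..u} s \<partial>uniform_law)" if u: "u \<in> {0..1}" for u
  proof -
    let ?A = "fst -` {..u} :: (real \<times> real) set"
    have A: "?A \<in> sets ?F"
      using in_vimage_algebra[of "{..u}" borel fst "space \<mu>"] by (simp add: space_\<mu>)
    have A': "?A \<in> sets \<mu>" using measurable_sets[OF fst_m, of "{..u}"] by (simp add: space_\<mu>)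
    \<comment> \<open>Passing to the complement in the second coordinate brings in \<open>f\<close>.
      As \<open>?A\<close> belongs to the sigma-algebra of the first coordinate, the conditional
      expectation may then replace \<open>f\<close> under the integral over
      \<open>?A\<close>.\<close>
    have eq: "({..u} \<times> {..v}) = ?A - {\<omega> \<in> ?A. v < snd \<omega>}" by auto
    have B: "{\<omega> \<in> ?A. v < snd \<omega>} \<in> sets \<mu>"
    proof -
      have "{\<omega> \<in> ?A. v < snd \<omega>} = ?A \<inter> (snd -` {v<..} \<inter> space \<mu>)" by (auto simp: space_\<mu>)
      then show ?thesis using A' by auto
    qed
    have "C u v = prob ?A - prob {\<omega> \<in> ?A. v < snd \<omega>}"
      unfolding C[OF u, symmetric] eq using A' B by (intro finite_measure_Diff) auto
    also have "prob ?A = (\<integral>\<omega>. indicator ?A \<omega> \<partial>\<mu>)" by (simp add: space_\<mu>)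
    also have "prob {\<omega> \<in> ?A. v < snd \<omega>} = (\<integral>\<omega>. indicator {\<omega> \<in> ?A. v < snd \<omega>} \<omega> \<partial>\<mu>)"
      by (simp add: space_\<mu>)
    also have "\<dots> = (\<integral>\<omega>\<in>?A. f (snd \<omega>) \<partial>\<mu>)"
      unfolding set_lebesgue_integral_def by (intro Bochner_Integration.integral_cong) (auto simp: f_def indicator_def)
    also have "\<dots> = (\<integral>\<omega>\<in>?A. real_cond_exp \<mu> ?F (\<lambda>\<omega>. f (snd \<omega>)) \<omega> \<partial>\<mu>)"
      by (rule F.real_cond_exp_intA[OF int_f A])
    also have "\<dots> = (\<integral>\<omega>\<in>?A. g' (fst \<omega>) \<partial>\<mu>)"
      unfolding set_lebesgue_integral_def using cond_exp A'
      by (intro integral_cong_AE) auto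
    also have "(\<integral>\<omega>. indicator ?A \<omega> \<partial>\<mu>) - (\<integral>\<omega>\<in>?A. g' (fst \<omega>) \<partial>\<mu>) = (\<integral>\<omega>. (1 - g' (fst \<omega>)) * indicator ?A \<omega> \<partial>\<mu>)"
      unfolding set_lebesgue_integral_def using A' int_g'
      by (subst Bochner_Integration.integral_diff[symmetric])
        (auto simp: algebra_simps less_top[symmetric] intro!: integrable_real_mult_indicator)
    finally have "ennreal (C u v) = (\<integral>\<^sup>+\<omega>. ennreal ((1 - g' (fst \<omega>)) * indicator ?A \<omega>) \<partial>\<mu>)"
      using g'_bounds A'
      by (subst nn_integral_eq_integral) (auto intro!: integrable_const_bound[of _ 1] simp: indicator_def)
    also have "\<dots> = (\<integral>\<^sup>+\<omega>. ennreal (1 - g' (fst \<omega>)) * indicator {..u} (fst \<omega>) \<partial>\<mu>)"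
      by (intro nn_integral_cong) (auto simp: indicator_def)
    also have "\<dots> = (\<integral>\<^sup>+s. ennreal (1 - g' s) * indicator {..u} s \<partial>uniform_law)"
      unfolding U[symmetric] by (subst nn_integral_distr) auto
    finally show ?thesis .
  qed
  moreover have "antimono (\<lambda>s. 1 - g' s)" using monoD[OF \<open>mono g'\<close>] by (intro antimonoI diff_left_mono)
  ultimately show ?thesis using g'_bounds by (intro exI[of _ "\<lambda>s. 1 - g' s"]) auto
qed

subsection \<open>Gaussian random walks and their noisy observations\<close>

text \<open>Independence makes the joint law a product, so Fubini integrates out \<open>Y\<close>
  while \<open>X\<close> is held fixed.\<close>

lemma (in prob_space) nn_integral_indep_var:
  assumes indep: "indep_var S X T Y" and [measurable]: "F \<in> borel_measurable (S \<Otimes>\<^sub>M T)"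
  shows "(\<integral>\<^sup>+\<omega>. F (X \<omega>, Y \<omega>) \<partial>M) = (\<integral>\<^sup>+\<omega>. (\<integral>\<^sup>+y. F (X \<omega>, y) \<partial>distr M T Y) \<partial>M)"
proof -
  have [measurable]: "X \<in> measurable M S" "Y \<in> measurable M T"
    and joint: "distr M S X \<Otimes>\<^sub>M distr M T Y = distr M (S \<Otimes>\<^sub>M T) (\<lambda>\<omega>. (X \<omega>, Y \<omega>))"
    using indep by (auto simp: indep_var_distribution_eq)
  interpret Y: prob_space "distr M T Y" by (rule prob_space_distr) simp
  have F: "F \<in> borel_measurable (distr M S X \<Otimes>\<^sub>M distr M T Y)" by simp
  have "(\<integral>\<^sup>+\<omega>. F (X \<omega>, Y \<omega>) \<partial>M) = (\<integral>\<^sup>+p. F p \<partial>(distr M S X \<Otimes>\<^sub>M distr M T Y))"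
    unfolding joint by (simp add: nn_integral_distr)
  also have "\<dots> = (\<integral>\<^sup>+x. (\<integral>\<^sup>+y. F (x, y) \<partial>distr M T Y) \<partial>distr M S X)"
    using Y.nn_integral_fst[OF F] by simp
  also have "\<dots> = (\<integral>\<^sup>+\<omega>. (\<integral>\<^sup>+y. F (X \<omega>, y) \<partial>distr M T Y) \<partial>M)"
    by (rule nn_integral_distr) (use Y.borel_measurable_nn_integral_fst[OF F] in simp_all)
  finally show ?thesis .
qed

text \<open>Given \<open>W\<close>, each constraint involves its own independent noise, so the
  conditional probability is a product of one factor per time. The lemma serves both the hidden
  Markov model with uniform noise and the explicit process with Gaussian noise.\<close>

lemma (in prob_space) emeasure_noisy_observations:
  fixes Q :: "'i \<Rightarrow> (real \<times> real) set"
  assumes indep: "indep_var S W (Pi\<^sub>M J (\<lambda>_. borel)) (\<lambda>\<omega>. \<lambda>n\<in>J. E n \<omega>)"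
    and iid: "iid M D E J" and J: "finite J" "J \<noteq> {}"
    and x [measurable]: "\<And>n. n \<in> J \<Longrightarrow> x n \<in> borel_measurable S"
    and Q: "\<And>n. n \<in> J \<Longrightarrow> Q n \<in> sets borel"
  shows "emeasure M {\<omega> \<in> space M. \<forall>n\<in>J. (x n (W \<omega>), E n \<omega>) \<in> Q n} =
    (\<integral>\<^sup>+\<omega>. (\<Prod>n\<in>J. emeasure D {e. (x n (W \<omega>), e) \<in> Q n}) \<partial>M)"
proof -
  have E: "indep_vars (\<lambda>_. borel) E J" and D: "\<And>n. n \<in> J \<Longrightarrow> distr M borel (E n) = D"
    using iid by (auto simp: iid_def)
  have Em [measurable]: "\<And>n. n \<in> J \<Longrightarrow> random_variable borel (E n)"
    using E by (auto simp: indep_vars_def2)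
  have Wm [measurable]: "W \<in> measurable M S" using indep by (simp add: indep_var_distribution_eq)
  note [measurable] = Q
  obtain n0 where n0: "n0 \<in> J" using J by auto
  have sets_D [measurable_cong]: "sets D = sets borel" using D[OF n0] by (metis sets_distr)
  interpret D: prob_space D using D[OF n0] prob_space_distr[OF Em[OF n0]] by simp
  interpret product_sigma_finite "\<lambda>_. D" ..
  have law: "distr M (Pi\<^sub>M J (\<lambda>_. borel)) (\<lambda>\<omega>. \<lambda>n\<in>J. E n \<omega>) = Pi\<^sub>M J (\<lambda>_. D)"
    using E D Em J by (simp add: indep_vars_iff_distr_eq_PiM' cong: PiM_cong)
  \<comment> \<open>The indicator of the joint event is written as a product over times, so that its
    integral over the product law of the noises factorizes.\<close>
  define F where "F p = (\<Prod>n\<in>J. indicator (Q n) (x n (fst p), snd p n) :: ennreal)" for p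
  have [measurable]: "F \<in> borel_measurable (S \<Otimes>\<^sub>M Pi\<^sub>M J (\<lambda>_. borel))"
    unfolding F_def
  proof (intro borel_measurable_prod_ennreal)
    fix n assume n: "n \<in> J"
    have "(\<lambda>p. (x n (fst p), snd p n :: real)) \<in> borel_measurable (S \<Otimes>\<^sub>M Pi\<^sub>M J (\<lambda>_. borel))"
      by (intro borel_measurable_Pair measurable_compose[OF measurable_fst x[OF n]]
        measurable_compose[OF measurable_snd measurable_component_singleton[OF n]])
    then show "(\<lambda>p. indicator (Q n) (x n (fst p), snd p n) :: ennreal)
        \<in> borel_measurable (S \<Otimes>\<^sub>M Pi\<^sub>M J (\<lambda>_. borel))"
      by (rule measurable_compose[OF _ borel_measurable_indicator[OF Q[OF n]]])
  qed
  have "{\<omega> \<in> space M. (x n (W \<omega>), E n \<omega>) \<in> Q n} \<in> sets M" if n: "n \<in> J" for n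
  proof -
    have "(\<lambda>\<omega>. (x n (W \<omega>), E n \<omega>)) \<in> borel_measurable M"
      using n by (intro borel_measurable_Pair) measurable
    from measurable_sets[OF this Q[OF n]]
    show ?thesis by (rule back_subst[of "\<lambda>B. B \<in> sets M"]) auto
  qed
  then have "{\<omega> \<in> space M. \<forall>n\<in>J. (x n (W \<omega>), E n \<omega>) \<in> Q n} \<in> sets M"
    using J(1) by (rule sets.sets_Collect_finite_All)
  then have "emeasure M {\<omega> \<in> space M. \<forall>n\<in>J. (x n (W \<omega>), E n \<omega>) \<in> Q n} =
      (\<integral>\<^sup>+\<omega>. indicator {\<omega> \<in> space M. \<forall>n\<in>J. (x n (W \<omega>), E n \<omega>) \<in> Q n} \<omega> \<partial>M)"
    by simp
  also have "\<dots> = (\<integral>\<^sup>+\<omega>. F (W \<omega>, \<lambda>n\<in>J. E n \<omega>) \<partial>M)"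
  proof (rule nn_integral_cong)
    fix \<omega> assume "\<omega> \<in> space M"
    then show "indicator {\<omega> \<in> space M. \<forall>n\<in>J. (x n (W \<omega>), E n \<omega>) \<in> Q n} \<omega> = F (W \<omega>, \<lambda>n\<in>J. E n \<omega>)"
      using J(1) by (auto simp: F_def indicator_def prod_zero_iff)
  qed
  also have "\<dots> = (\<integral>\<^sup>+\<omega>. (\<integral>\<^sup>+e. F (W \<omega>, e) \<partial>Pi\<^sub>M J (\<lambda>_. D)) \<partial>M)"
    by (subst nn_integral_indep_var[OF indep]) (simp_all add: law)
  also have "\<dots> = (\<integral>\<^sup>+\<omega>. (\<Prod>n\<in>J. emeasure D {e. (x n (W \<omega>), e) \<in> Q n}) \<partial>M)"
  proof (rule nn_integral_cong)
    fix \<omega> assume \<omega>: "\<omega> \<in> space M"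
    have sets: "{e. (x n (W \<omega>), e) \<in> Q n} \<in> sets D" if "n \<in> J" for n
      using measurable_sets[of "Pair (x n (W \<omega>))" borel borel "Q n"] Q[OF that]
      by (simp add: vimage_def sets_D)
    have "(\<integral>\<^sup>+e. F (W \<omega>, e) \<partial>Pi\<^sub>M J (\<lambda>_. D)) =
        (\<integral>\<^sup>+e. (\<Prod>n\<in>J. indicator {e. (x n (W \<omega>), e) \<in> Q n} (e n)) \<partial>Pi\<^sub>M J (\<lambda>_. D))"
      by (simp add: F_def indicator_def)
    also have "\<dots> = (\<Prod>n\<in>J. \<integral>\<^sup>+e. indicator {e. (x n (W \<omega>), e) \<in> Q n} e \<partial>D)"
      using J(1) sets by (intro product_nn_integral_prod) auto
    also have "\<dots> = (\<Prod>n\<in>J. emeasure D {e. (x n (W \<omega>), e) \<in> Q n})"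
      using sets by (intro prod.cong) auto
    finally show "(\<integral>\<^sup>+e. F (W \<omega>, e) \<partial>Pi\<^sub>M J (\<lambda>_. D)) =
        (\<Prod>n\<in>J. emeasure D {e. (x n (W \<omega>), e) \<in> Q n})" .
  qed
  finally show ?thesis .
qed

section \<open>Products of decreasing kernels along the random walk\<close>

locale gaussian_walk = prob_space M for M :: "'a measure" +
  fixes \<xi> X :: "nat \<Rightarrow> 'a \<Rightarrow> real"
  assumes increments: "iid M (normal_law 1) \<xi> {1..}"
    and X_eq: "X n \<omega> = (\<Sum>i=1..n. \<xi> i \<omega>)"
begin

lemma measurable_increment [measurable]: "1 \<le> n \<Longrightarrow> \<xi> n \<in> borel_measurable M"
  using increments by (auto simp: iid_def indep_vars_def2)

lemma measurable_X [measurable]: "X n \<in> borel_measurable M"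
proof -
  have "X n = (\<lambda>\<omega>. \<Sum>i=1..n. \<xi> i \<omega>)" by (simp add: X_eq fun_eq_iff)
  then show ?thesis by simp
qed

lemma X_Suc: "X (Suc n) \<omega> = X n \<omega> + \<xi> (Suc n) \<omega>"
  by (simp add: X_eq)

text \<open>The first \<open>k\<close> increments determine the walk up to time \<open>k\<close> and
  are independent of the next increment, which can thus be integrated out.\<close>

lemma nn_integral_step:
  assumes L [measurable]: "\<And>n. L n \<in> borel_measurable borel" and h [measurable]: "h \<in> borel_measurable borel"
  shows "(\<integral>\<^sup>+\<omega>. (\<Prod>n=1..k. L n (X n \<omega>)) * h (X (Suc k) \<omega>) \<partial>M) =
    (\<integral>\<^sup>+\<omega>. (\<Prod>n=1..k. L n (X n \<omega>)) * (\<integral>\<^sup>+z. h (X k \<omega> + z) \<partial>normal_law 1) \<partial>M)"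
proof -
  let ?W = "\<lambda>\<omega>. \<lambda>i\<in>{1..k}. \<xi> i \<omega>"
  have "indep_vars (\<lambda>_. borel) \<xi> {1..}" and law: "distr M borel (\<xi> (Suc k)) = normal_law 1"
    using increments by (auto simp: iid_def)
  then have indep: "indep_var (Pi\<^sub>M {1..k} (\<lambda>_. borel)) ?W (Pi\<^sub>M {Suc k} (\<lambda>_. borel)) (\<lambda>\<omega>. \<lambda>i\<in>{Suc k}. \<xi> i \<omega>)"
    by (intro indep_var_restrict) auto
  \<comment> \<open>The integrand is expressed through the two independent blocks of increments, the
    walk being rebuilt by partial sums.\<close>
  define F where "F p = (\<Prod>n=1..k. L n (\<Sum>i=1..n. fst p i)) * h ((\<Sum>i=1..k. fst p i) + snd p (Suc k))"
    for p :: "(nat \<Rightarrow> real) \<times> (nat \<Rightarrow> real)"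
  have [measurable]: "(\<lambda>p :: (nat \<Rightarrow> real) \<times> (nat \<Rightarrow> real). \<Sum>i=1..n. fst p i)
      \<in> borel_measurable (Pi\<^sub>M {1..k} (\<lambda>_. borel) \<Otimes>\<^sub>M Pi\<^sub>M {Suc k} (\<lambda>_. borel :: real measure))"
    if "n \<in> {1..k} \<or> n = k" for n
  proof (rule borel_measurable_sum[of "{1..n}" "\<lambda>i p. fst p i"])
    fix i assume "i \<in> {1..n}"
    with that have "i \<in> {1..k}" by auto
    then show "(\<lambda>p :: (nat \<Rightarrow> real) \<times> (nat \<Rightarrow> real). fst p i) \<in> borel_measurable (Pi\<^sub>M {1..k} (\<lambda>_. borel) \<Otimes>\<^sub>M Pi\<^sub>M {Suc k} (\<lambda>_. borel :: real measure))"
      by (rule measurable_compose[OF measurable_fst measurable_component_singleton])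
  qed
  have [measurable]: "F \<in> borel_measurable (Pi\<^sub>M {1..k} (\<lambda>_. borel) \<Otimes>\<^sub>M Pi\<^sub>M {Suc k} (\<lambda>_. borel))"
    unfolding F_def by measurable
  have W: "(\<Sum>i=1..n. ?W \<omega> i) = X n \<omega>" if "n \<le> k" for n \<omega>
    using that by (auto simp: X_eq intro!: sum.cong)
  have F_W: "F (?W \<omega>, v) = (\<Prod>n=1..k. L n (X n \<omega>)) * h (X k \<omega> + v (Suc k))" for \<omega> v
    unfolding F_def using W by simp
  have "(\<integral>\<^sup>+\<omega>. (\<Prod>n=1..k. L n (X n \<omega>)) * h (X (Suc k) \<omega>) \<partial>M) =
      (\<integral>\<^sup>+\<omega>. F (?W \<omega>, \<lambda>i\<in>{Suc k}. \<xi> i \<omega>) \<partial>M)"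
    unfolding F_W by (simp add: X_Suc)
  also have "\<dots> = (\<integral>\<^sup>+\<omega>. (\<integral>\<^sup>+v. F (?W \<omega>, v) \<partial>distr M (Pi\<^sub>M {Suc k} (\<lambda>_. borel)) (\<lambda>\<omega>. \<lambda>i\<in>{Suc k}. \<xi> i \<omega>)) \<partial>M)"
    by (rule nn_integral_indep_var[OF indep]) measurable
  also have "\<dots> = (\<integral>\<^sup>+\<omega>. (\<Prod>n=1..k. L n (X n \<omega>)) * (\<integral>\<^sup>+\<omega>'. h (X k \<omega> + \<xi> (Suc k) \<omega>') \<partial>M) \<partial>M)"
    unfolding F_W by (intro nn_integral_cong) (simp add: nn_integral_distr nn_integral_cmult)
  also have "\<dots> = (\<integral>\<^sup>+\<omega>. (\<Prod>n=1..k. L n (X n \<omega>)) * (\<integral>\<^sup>+z. h (X k \<omega> + z) \<partial>normal_law 1) \<partial>M)"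
    unfolding law[symmetric] by (simp add: nn_integral_distr)
  finally show ?thesis .
qed

lemma nn_integral_X:
  assumes "1 \<le> n" and "h \<in> borel_measurable borel"
  shows "(\<integral>\<^sup>+\<omega>. h (X n \<omega>) \<partial>M) = (\<integral>\<^sup>+x. h x \<partial>normal_law n)"
  using assms
proof (induction n arbitrary: h rule: nat_induct_at_least)
  case base
  have "distr M borel (\<xi> 1) = normal_law 1" using increments by (simp add: iid_def)
  moreover have "(\<integral>\<^sup>+\<omega>. h (\<xi> 1 \<omega>) \<partial>M) = (\<integral>\<^sup>+x. h x \<partial>distr M borel (\<xi> 1))"
    using base by (simp add: nn_integral_distr)
  ultimately show ?case by (simp add: X_eq)
next
  case (Suc n)
  note [measurable] = Suc.prems
  interpret N: prob_space "normal_law 1" by (simp add: prob_space_normal_law)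
  have "(\<integral>\<^sup>+\<omega>. h (X (Suc n) \<omega>) \<partial>M) = (\<integral>\<^sup>+\<omega>. (\<integral>\<^sup>+z. h (X n \<omega> + z) \<partial>normal_law 1) \<partial>M)"
    using nn_integral_step[of "\<lambda>_ _. 1" h n] by simp
  also have "\<dots> = (\<integral>\<^sup>+x. (\<integral>\<^sup>+z. h (x + z) \<partial>normal_law 1) \<partial>normal_law n)"
    by (rule Suc.IH) measurable
  \<comment> \<open>With weight 1 the inner integral of the bridge formula equals 1, and the formula
    becomes the convolution rule for normal laws.\<close>
  also have "\<dots> = (\<integral>\<^sup>+x. h x \<partial>normal_law (Suc n))"
    using nn_integral_normal_bridge[of n 1 "\<lambda>_. 1" h] Suc.hyps N.emeasure_space_1
    by (simp add: add.commute)
  finally show ?case .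
qed

lemma distr_X:
  assumes "1 \<le> n"
  shows "distr M borel (X n) = normal_law n"
proof (rule measure_eqI)
  fix A assume "A \<in> sets (distr M borel (X n))"
  then show "emeasure (distr M borel (X n)) A = emeasure (normal_law n) A"
    using nn_integral_X[OF assms, of "indicator A"] nn_integral_distr[of "X n" M borel "indicator A"]
    by simp
qed simp

text \<open>
  The weight \<open>b y\<close> is the conditional expectation of the product given \<open>X k = y\<close>. Given
  \<open>X (Suc k) = y\<close>, the variable \<open>X k\<close> is normal with mean \<open>k / (k + 1) * y\<close> and a variance not
  depending on \<open>y\<close>, so \<open>b\<close> inherits monotonicity from the factors.
\<close>

lemma past_weight:
  assumes "1 \<le> k" and L [measurable]: "\<And>n. L n \<in> borel_measurable borel" and "\<And>n. antimono (L n)"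
  shows "\<exists>b \<in> borel_measurable borel. antimono b \<and>
    (\<forall>h \<in> borel_measurable borel.
      (\<integral>\<^sup>+\<omega>. (\<Prod>n=1..<k. L n (X n \<omega>)) * h (X k \<omega>) \<partial>M) = (\<integral>\<^sup>+y. b y * h y \<partial>normal_law k))"
  using assms(1)
proof (induction k rule: nat_induct_at_least)
  case base
  show ?case
    using nn_integral_X[of 1] by (intro bexI[of _ "\<lambda>_. 1"]) (auto simp: monotone_on_def)
next
  case (Suc k)
  then obtain b where [measurable]: "b \<in> borel_measurable borel" and "antimono b" and
    b: "\<And>h. h \<in> borel_measurable borel \<Longrightarrow>
      (\<integral>\<^sup>+\<omega>. (\<Prod>n=1..<k. L n (X n \<omega>)) * h (X k \<omega>) \<partial>M) = (\<integral>\<^sup>+y. b y * h y \<partial>normal_law k)"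
    by auto
  \<comment> \<open>These are the bridge constants for variance \<open>k\<close> of
    \<open>X k\<close> and variance 1 of the next increment. The new weight \<open>b'\<close>
    averages the old weight times the factor at time \<open>k\<close> over the law of
    \<open>X k\<close> given \<open>X (Suc k)\<close>.\<close>
  define c where "c = real k / (real k + 1)"
  define s where "s = sqrt (real k * 1 / (real k + 1))"
  define b' where "b' y = (\<integral>\<^sup>+w. b (c * y + s * w) * L k (c * y + s * w) \<partial>normal_law 1)" for y
  interpret N: sigma_finite_measure "normal_law 1" by (simp add: sigma_finite_normal_law)
  show ?case
  proof (intro bexI[of _ b'] conjI ballI)
    show "b' \<in> borel_measurable borel" unfolding b'_def by measurable
    \<comment> \<open>For each fixed \<open>w\<close> the point \<open>c * y + s * w\<close> moves
      upwards with \<open>y\<close>, so the decreasing integrand decreases in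
      \<open>y\<close>.\<close>
    have "0 \<le> c" by (simp add: c_def)
    then show "antimono b'"
      unfolding b'_def using \<open>antimono b\<close> assms(3)
      by (intro antimonoI nn_integral_mono mult_mono) (auto intro!: antimonoD[of b] antimonoD[of "L k"] mult_left_mono)
    fix h :: "real \<Rightarrow> ennreal" assume h [measurable]: "h \<in> borel_measurable borel"
    have "(\<integral>\<^sup>+\<omega>. (\<Prod>n=1..<Suc k. L n (X n \<omega>)) * h (X (Suc k) \<omega>) \<partial>M) =
        (\<integral>\<^sup>+\<omega>. (\<Prod>n=1..<Suc k. L n (X n \<omega>)) * (\<integral>\<^sup>+z. h (X k \<omega> + z) \<partial>normal_law 1) \<partial>M)"
      using nn_integral_step[of L h k, OF L h] by (simp add: atLeastLessThanSuc_atLeastAtMost)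
    also have "\<dots> = (\<integral>\<^sup>+\<omega>. (\<Prod>n=1..<k. L n (X n \<omega>)) * (L k (X k \<omega>) * (\<integral>\<^sup>+z. h (X k \<omega> + z) \<partial>normal_law 1)) \<partial>M)"
      using Suc.hyps by (simp add: prod.atLeastLessThan_Suc mult.assoc)
    also have "\<dots> = (\<integral>\<^sup>+y. b y * (L k y * (\<integral>\<^sup>+z. h (y + z) \<partial>normal_law 1)) \<partial>normal_law k)"
      by (rule b) measurable
    also have "\<dots> = (\<integral>\<^sup>+y. (b y * L k y) * (\<integral>\<^sup>+z. h (y + z) \<partial>normal_law 1) \<partial>normal_law k)"
      by (simp add: mult.assoc)
    also have "\<dots> = (\<integral>\<^sup>+y. b' y * h y \<partial>normal_law (Suc k))"
      using nn_integral_normal_bridge[of k 1 "\<lambda>y. b y * L k y" h] Suc.hyps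
      by (simp add: b'_def c_def s_def add.commute)
    finally show "(\<integral>\<^sup>+\<omega>. (\<Prod>n=1..<Suc k. L n (X n \<omega>)) * h (X (Suc k) \<omega>) \<partial>M) =
      (\<integral>\<^sup>+y. b' y * h y \<partial>normal_law (Suc k))" .
  qed
qed

text \<open>In the induction step the last factor is exchanged while the past still carries
  \<open>L\<close>; the induction hypothesis then exchanges the earlier factors. The arbitrary
  decreasing \<open>h\<close> absorbs the factors already exchanged together with the future of the
  walk.\<close>

lemma nn_integral_prod_mult_le:
  fixes L L' :: "nat \<Rightarrow> real \<Rightarrow> ennreal"
  assumes L [measurable]: "\<And>n. L n \<in> borel_measurable borel" and L' [measurable]: "\<And>n. L' n \<in> borel_measurable borel"
    and anti: "\<And>n. antimono (L n)" and anti': "\<And>n. antimono (L' n)"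
    and le1: "\<And>n x. L n x \<le> 1" and le1': "\<And>n x. L' n x \<le> 1"
    and le: "\<And>n x. 1 \<le> n \<Longrightarrow>
      (\<integral>\<^sup>+y. L n y * indicator {..x} y \<partial>normal_law n) \<le> (\<integral>\<^sup>+y. L' n y * indicator {..x} y \<partial>normal_law n)"
    and "1 \<le> k" "h \<in> borel_measurable borel" "antimono h"
  shows "(\<integral>\<^sup>+\<omega>. (\<Prod>n=1..<k. L n (X n \<omega>)) * h (X k \<omega>) \<partial>M) \<le>
    (\<integral>\<^sup>+\<omega>. (\<Prod>n=1..<k. L' n (X n \<omega>)) * h (X k \<omega>) \<partial>M)"
  using assms(8-)
proof (induction k arbitrary: h rule: nat_induct_at_least)
  case base
  show ?case by simp
next
  case (Suc k)
  note h [measurable] = Suc.prems(1)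
  interpret N: prob_space "normal_law k" using Suc.hyps by (simp add: prob_space_normal_law)
  interpret N1: sigma_finite_measure "normal_law 1" by (simp add: sigma_finite_normal_law)
  \<comment> \<open>This is the conditional expectation of \<open>h (X (Suc k))\<close> given
    \<open>X k = x\<close>. It inherits monotonicity because the increment does not depend on
    \<open>x\<close>.\<close>
  define g where "g x = (\<integral>\<^sup>+z. h (x + z) \<partial>normal_law 1)" for x
  have g [measurable]: "g \<in> borel_measurable borel" unfolding g_def by measurable
  have "antimono g"
    unfolding g_def using Suc.prems(2) by (intro antimonoI nn_integral_mono) (auto intro!: antimonoD[of h])
  obtain b where [measurable]: "b \<in> borel_measurable borel" and "antimono b" and
    b: "\<And>h. h \<in> borel_measurable borel \<Longrightarrow>
      (\<integral>\<^sup>+\<omega>. (\<Prod>n=1..<k. L n (X n \<omega>)) * h (X k \<omega>) \<partial>M) = (\<integral>\<^sup>+y. b y * h y \<partial>normal_law k)"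
    using past_weight[where k = k and L = L] Suc.hyps L anti by auto
  have step: "(\<integral>\<^sup>+\<omega>. (\<Prod>n=1..<Suc k. K n (X n \<omega>)) * h (X (Suc k) \<omega>) \<partial>M) =
      (\<integral>\<^sup>+\<omega>. (\<Prod>n=1..<k. K n (X n \<omega>)) * (K k (X k \<omega>) * g (X k \<omega>)) \<partial>M)"
    if K [measurable]: "\<And>n. K n \<in> borel_measurable borel" for K :: "nat \<Rightarrow> real \<Rightarrow> ennreal"
    using nn_integral_step[of K h k, OF K h] Suc.hyps
    by (simp add: atLeastLessThanSuc_atLeastAtMost[symmetric] g_def prod.atLeastLessThan_Suc mult.assoc)
  have "(\<integral>\<^sup>+\<omega>. (\<Prod>n=1..<Suc k. L n (X n \<omega>)) * h (X (Suc k) \<omega>) \<partial>M) =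
      (\<integral>\<^sup>+y. b y * (L k y * g y) \<partial>normal_law k)"
    unfolding step[of L, OF L] by (rule b) measurable
  \<comment> \<open>Reading the factor at time \<open>k\<close> as a density leaves the decreasing
    function \<open>b y * g y\<close> of past and future, and the two densities are ordered on
    half-lines by \<open>le\<close>.\<close>
  also have "\<dots> = (\<integral>\<^sup>+y. b y * g y \<partial>density (normal_law k) (L k))"
    by (subst nn_integral_density) (simp_all add: ac_simps)
  also have "\<dots> \<le> (\<integral>\<^sup>+y. b y * g y \<partial>density (normal_law k) (L' k))"
  proof (rule nn_integral_antimono_le)
    show "antimono (\<lambda>y. b y * g y)"
      using \<open>antimono b\<close> \<open>antimono g\<close> by (auto intro!: antimonoI mult_mono dest: antimonoD)
    show "emeasure (density (normal_law k) (L k)) {..x} \<le> emeasure (density (normal_law k) (L' k)) {..x}" for x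
      using le[OF Suc.hyps] by (simp add: emeasure_density)
  qed (use le1 le1' in \<open>auto intro!: finite_measure.axioms N.finite_measure_density_le_1\<close>)
  also have "\<dots> = (\<integral>\<^sup>+y. b y * (L' k y * g y) \<partial>normal_law k)"
    by (subst nn_integral_density) (simp_all add: ac_simps)
  also have "\<dots> = (\<integral>\<^sup>+\<omega>. (\<Prod>n=1..<k. L n (X n \<omega>)) * (L' k (X k \<omega>) * g (X k \<omega>)) \<partial>M)"
    by (rule b[symmetric]) measurable
  also have "\<dots> \<le> (\<integral>\<^sup>+\<omega>. (\<Prod>n=1..<k. L' n (X n \<omega>)) * (L' k (X k \<omega>) * g (X k \<omega>)) \<partial>M)"
    using anti' \<open>antimono g\<close>
    by (intro Suc.IH) (auto intro!: antimonoI mult_mono dest: antimonoD)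
  also have "\<dots> = (\<integral>\<^sup>+\<omega>. (\<Prod>n=1..<Suc k. L' n (X n \<omega>)) * h (X (Suc k) \<omega>) \<partial>M)"
    unfolding step[of L', OF L'] ..
  finally show ?case .
qed

lemma nn_integral_prod_le:
  fixes L L' :: "nat \<Rightarrow> real \<Rightarrow> ennreal"
  assumes "\<And>n. L n \<in> borel_measurable borel" and "\<And>n. L' n \<in> borel_measurable borel"
    and "\<And>n. antimono (L n)" and "\<And>n. antimono (L' n)"
    and "\<And>n x. L n x \<le> 1" and "\<And>n x. L' n x \<le> 1"
    and "\<And>n x. 1 \<le> n \<Longrightarrow>
      (\<integral>\<^sup>+y. L n y * indicator {..x} y \<partial>normal_law n) \<le> (\<integral>\<^sup>+y. L' n y * indicator {..x} y \<partial>normal_law n)"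
  shows "(\<integral>\<^sup>+\<omega>. (\<Prod>n=1..d. L n (X n \<omega>)) \<partial>M) \<le> (\<integral>\<^sup>+\<omega>. (\<Prod>n=1..d. L' n (X n \<omega>)) \<partial>M)"
  using nn_integral_prod_mult_le[OF assms, of "Suc d" "\<lambda>_. 1"]
  by (simp add: atLeastLessThanSuc_atLeastAtMost monotone_on_def)

end

section \<open>Observation kernels of a hidden Markov model\<close>

lemma (in prob_space) hidden_markov_observations:
  assumes hmm: "hidden_markov_model M X Xs" and X0: "\<And>\<omega>. X 0 \<omega> = 0"
  shows "\<exists>fs. (\<forall>n. fs n \<in> borel_measurable borel) \<and>
    (\<forall>J A t. finite J \<longrightarrow> J \<noteq> {} \<longrightarrow> (\<forall>n\<in>J. A n \<in> sets borel) \<longrightarrow>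
      emeasure M {\<omega> \<in> space M. \<forall>n\<in>J. X n \<omega> \<in> A n \<and> Xs n \<omega> \<le> t} =
      (\<integral>\<^sup>+\<omega>. (\<Prod>n\<in>J. emeasure uniform_law {e. fs n (X n \<omega>, e) \<le> t} * indicator (A n) (X n \<omega>)) \<partial>M))"
proof -
  define I :: "(nat + nat) set" where "I = Inl ` {1..} \<union> Inr ` UNIV"
  from hmm obtain f fs \<delta> \<epsilon> where [measurable]: "\<And>n. X n \<in> borel_measurable M" "\<And>n. Xs n \<in> borel_measurable M"
    and f: "\<And>n. 1 \<le> n \<Longrightarrow> f n \<in> borel_measurable borel" and fs: "\<And>n. fs n \<in> borel_measurable borel"
    and iid: "iid M uniform_law (case_sum \<delta> \<epsilon>) I"
    and X_rec: "\<And>n. 1 \<le> n \<Longrightarrow> AE \<omega> in M. X n \<omega> = f n (X (n - 1) \<omega>, \<delta> n \<omega>)"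
    and Xs_eq: "\<And>n. AE \<omega> in M. Xs n \<omega> = fs n (X n \<omega>, \<epsilon> n \<omega>)"
    unfolding hidden_markov_model_def Let_def I_def by blast
  define Z where "Z = case_sum \<delta> \<epsilon>"
  have indep: "indep_vars (\<lambda>_. borel) Z I" using iid by (simp add: iid_def Z_def)
  then have Z [measurable]: "\<And>i. i \<in> I \<Longrightarrow> Z i \<in> borel_measurable M" by (auto simp: indep_vars_def2)
  \<comment> \<open>Unrolling the recursion from the start value 0 makes the hidden state a function
    of the transition noises alone. The recursion holds only almost surely, hence so does the
    agreement with \<open>X n\<close>.\<close>
  define state where "state n w = rec_nat 0 (\<lambda>m y. f (Suc m) (y, w (Inl (Suc m)))) n"
    for n and w :: "nat + nat \<Rightarrow> real"
  define W where "W \<omega> = (\<lambda>i\<in>Inl ` {1..}. Z i \<omega>)" for \<omega>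
  have W [measurable]: "W \<in> measurable M (Pi\<^sub>M (Inl ` {1..}) (\<lambda>_. borel))"
    unfolding W_def using Z by (intro measurable_restrict) (auto simp: I_def)
  have state: "state n \<in> borel_measurable (Pi\<^sub>M (Inl ` {1..}) (\<lambda>_. borel))" for n
  proof (induction n)
    case 0 then show ?case by (simp add: state_def)
  next
    case (Suc n)
    have "(\<lambda>w. (state n w, w (Inl (Suc n)))) \<in> borel_measurable (Pi\<^sub>M (Inl ` {1..}) (\<lambda>_. borel))"
      by (intro borel_measurable_Pair Suc measurable_component_singleton) auto
    from measurable_compose[OF this f[of "Suc n"]] show ?case by (simp add: state_def)
  qed
  have X_state: "AE \<omega> in M. X n \<omega> = state n (W \<omega>)" for n
  proof (induction n)
    case 0 then show ?case by (simp add: state_def X0)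
  next
    case (Suc n)
    have "W \<omega> (Inl (Suc n)) = \<delta> (Suc n) \<omega>" for \<omega> by (simp add: W_def Z_def)
    then have "state (Suc n) (W \<omega>) = f (Suc n) (state n (W \<omega>), \<delta> (Suc n) \<omega>)" for \<omega> by (simp add: state_def)
    moreover note Suc X_rec[of "Suc n"]
    ultimately show ?case by auto
  qed
  show ?thesis
  proof (intro exI[of _ fs] conjI allI impI)
    fix J :: "nat set" and A :: "nat \<Rightarrow> real set" and t :: real
    assume J: "finite J" "J \<noteq> {}" and A: "\<forall>n\<in>J. A n \<in> sets borel"
    define Q where "Q i = {p. fst p \<in> A (projr i) \<and> fs (projr i) p \<le> t}" for i :: "nat + nat"
    have Q: "Q (Inr n) \<in> sets borel" if "n \<in> J" for n
    proof -
      have [measurable]: "A n \<in> sets borel" using A that by auto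
      have "Q (Inr n) = (fst -` A n \<inter> space borel) \<inter> (fs n -` {..t} \<inter> space borel)"
        by (auto simp: Q_def)
      moreover have "fst \<in> borel_measurable (borel :: (real \<times> real) measure)"
        by (simp flip: borel_prod)
      ultimately show ?thesis
        using measurable_sets[OF fs[of n], of "{..t}"] measurable_sets[of fst borel borel "A n"] by simp
    qed
    have emeasure_Q: "emeasure uniform_law {e. (y, e) \<in> Q (Inr n)} =
        emeasure uniform_law {e. fs n (y, e) \<le> t} * indicator (A n) y" for n y
      by (auto simp: Q_def indicator_def)
    \<comment> \<open>Transition noises carry \<open>Inl\<close> indices and observation noises
      \<open>Inr\<close> indices; disjoint index sets of one independent family give independent
      blocks.\<close>
    have ind: "indep_var (Pi\<^sub>M (Inl ` {1..}) (\<lambda>_. borel)) W (Pi\<^sub>M (Inr ` J) (\<lambda>_. borel)) (\<lambda>\<omega>. \<lambda>i\<in>Inr ` J. Z i \<omega>)"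
      unfolding W_def by (rule indep_var_restrict[OF indep]) (auto simp: I_def)
    have iid_J: "iid M uniform_law Z (Inr ` J)"
    proof -
      have "Inr ` J \<subseteq> I" by (auto simp: I_def)
      then show ?thesis
        using indep_vars_subset[OF indep] iid unfolding iid_def Z_def by blast
    qed
    have Z_Inr: "Z (Inr n) = \<epsilon> n" for n by (simp add: Z_def)
    have obs: "{\<omega> \<in> space M. (state n (W \<omega>), \<epsilon> n \<omega>) \<in> Q (Inr n)} \<in> sets M" if "n \<in> J" for n
    proof -
      have "\<epsilon> n \<in> borel_measurable M" using Z[of "Inr n"] by (simp add: I_def Z_Inr)
      then have "(\<lambda>\<omega>. (state n (W \<omega>), \<epsilon> n \<omega>)) \<in> borel_measurable M"
        by (intro borel_measurable_Pair measurable_compose[OF W state])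
      from measurable_sets[OF this Q[OF that]]
      show ?thesis by (rule back_subst[of "\<lambda>B. B \<in> sets M"]) auto
    qed
    have obs': "{\<omega> \<in> space M. X n \<omega> \<in> A n \<and> Xs n \<omega> \<le> t} \<in> sets M" if "n \<in> J" for n
    proof -
      have [measurable]: "A n \<in> sets borel" using A that by auto
      show ?thesis by measurable
    qed
    have "AE \<omega> in M. \<forall>n\<in>J. X n \<omega> = state n (W \<omega>) \<and> Xs n \<omega> = fs n (X n \<omega>, \<epsilon> n \<omega>)"
      using X_state Xs_eq by (intro AE_finite_allI[OF J(1)]) auto
    then have "emeasure M {\<omega> \<in> space M. \<forall>n\<in>J. X n \<omega> \<in> A n \<and> Xs n \<omega> \<le> t} =
        emeasure M {\<omega> \<in> space M. \<forall>n\<in>J. (state n (W \<omega>), \<epsilon> n \<omega>) \<in> Q (Inr n)}"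
      using obs obs' J by (intro emeasure_eq_AE sets.sets_Collect_finite_All) (auto simp: Q_def)
    also have "\<dots> = emeasure M {\<omega> \<in> space M. \<forall>i\<in>Inr ` J. (state (projr i) (W \<omega>), Z i \<omega>) \<in> Q i}"
      by (simp add: Z_Inr)
    also have "\<dots> = (\<integral>\<^sup>+\<omega>. (\<Prod>i\<in>Inr ` J. emeasure uniform_law {e. (state (projr i) (W \<omega>), e) \<in> Q i}) \<partial>M)"
      by (rule emeasure_noisy_observations[OF ind iid_J]) (use J Q state in auto)
    also have "\<dots> = (\<integral>\<^sup>+\<omega>. (\<Prod>n\<in>J. emeasure uniform_law {e. fs n (state n (W \<omega>), e) \<le> t} * indicator (A n) (state n (W \<omega>))) \<partial>M)"
      by (simp add: prod.reindex emeasure_Q)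
    also have "\<dots> = (\<integral>\<^sup>+\<omega>. (\<Prod>n\<in>J. emeasure uniform_law {e. fs n (X n \<omega>, e) \<le> t} * indicator (A n) (X n \<omega>)) \<partial>M)"
    proof (rule nn_integral_cong_AE)
      have "AE \<omega> in M. \<forall>n\<in>J. X n \<omega> = state n (W \<omega>)" using X_state by (intro AE_finite_allI[OF J(1)])
      then show "AE \<omega> in M. (\<Prod>n\<in>J. emeasure uniform_law {e. fs n (state n (W \<omega>), e) \<le> t} * indicator (A n) (state n (W \<omega>))) =
          (\<Prod>n\<in>J. emeasure uniform_law {e. fs n (X n \<omega>, e) \<le> t} * indicator (A n) (X n \<omega>))"
        by eventually_elim (auto intro!: prod.cong)
    qed
    finally show "emeasure M {\<omega> \<in> space M. \<forall>n\<in>J. X n \<omega> \<in> A n \<and> Xs n \<omega> \<le> t} =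
      (\<integral>\<^sup>+\<omega>. (\<Prod>n\<in>J. emeasure uniform_law {e. fs n (X n \<omega>, e) \<le> t} * indicator (A n) (X n \<omega>)) \<partial>M)" .
  qed (rule fs)
qed

text \<open>The decreasing version \<open>K'\<close> is the conditional copula probability
  \<open>k\<close> evaluated at the distribution function of \<open>X n\<close>. Its half-line
  integrals are copula values: the Gaussian copula bounds them from below, and the trivial bound by
  the smaller margin from above.\<close>

lemma (in gaussian_walk) observation_kernel_bounds:
  assumes n: "1 \<le> n" and \<sigma>: "0 < \<sigma>" and t: "0 \<le> t" and [measurable]: "Y \<in> borel_measurable M"
    and F: "cdf (distr M borel Y) \<in> F_class n \<sigma>"
    and copula: "copula_of M (X n) Y C" and C: "C \<in> C_class n \<sigma>"
    and K [measurable]: "K \<in> borel_measurable borel" and K_le: "\<And>y. K y \<le> 1"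
    and K_eq: "\<And>x. emeasure M {\<omega> \<in> space M. X n \<omega> \<le> x \<and> Y \<omega> \<le> t} = (\<integral>\<^sup>+y. K y * indicator {..x} y \<partial>normal_law n)"
  shows "\<exists>K' \<in> borel_measurable borel. antimono K' \<and> (\<forall>y. K' y \<le> (1 :: ennreal)) \<and>
    (AE y in normal_law n. K y = K' y) \<and>
    (\<forall>x. (\<integral>\<^sup>+y. emeasure (normal_law 1) {e. y + \<sigma> * e \<le> t} * indicator {..x} y \<partial>normal_law n) \<le>
      (\<integral>\<^sup>+y. K' y * indicator {..x} y \<partial>normal_law n)) \<and>
    (\<forall>x. (\<integral>\<^sup>+y. K' y * indicator {..x} y \<partial>normal_law n) \<le>
      (\<integral>\<^sup>+y. indicator {..t} y * indicator {..x} y \<partial>normal_law n))"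
proof -
  have pos: "0 < real n" using n by simp
  let ?N = "normal_law (real n)"
  let ?F = "cdf ?N"
  interpret N: real_distribution ?N using pos by (rule real_distribution_normal_law)
  interpret Y: real_distribution "distr M borel Y" by (rule real_distribution_distr) simp
  define v where "v = cdf (distr M borel Y) t"
  have v: "v \<in> {0..1}" using Y.cdf_nonneg Y.cdf_bounded_prob by (simp add: v_def)
  have F01: "?F x \<in> {0..1}" for x using N.cdf_nonneg N.cdf_bounded_prob by simp
  have joint: "measure M {\<omega> \<in> space M. X n \<omega> \<le> x \<and> Y \<omega> \<le> t} = C (?F x) v" for x
    using copula by (simp add: copula_of_def v_def distr_X[OF n])
  have v_le: "v \<le> ?F t" and v_ge: "cdf (normal_law (real n + \<sigma>\<^sup>2)) t \<le> v"
    using F t by (auto simp: F_class_def v_def)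
  have lo: "gaussian_copula (sqrt (real n / (real n + \<sigma>\<^sup>2))) (?F x) v \<le> C (?F x) v" for x
    using C v F01 by (auto simp: C_class_def lo_ge_def)
  from C v obtain k where "antimono k" and k: "\<And>x. 0 \<le> k x \<and> k x \<le> 1"
    and k_eq: "\<And>u. u \<in> {0..1} \<Longrightarrow> ennreal (C u v) = (\<integral>\<^sup>+s. ennreal (k s) * indicator {..u} s \<partial>uniform_law)"
    using SI_copula_density[of C v] by (auto simp: C_class_def)
  have "mono (\<lambda>x. - k x)" using antimonoD[OF \<open>antimono k\<close>] by (auto intro!: monoI)
  from borel_measurable_mono[OF this] have [measurable]: "k \<in> borel_measurable borel" by simp
  have [measurable]: "?F \<in> borel_measurable borel"
    using N.cdf_nondecreasing by (intro borel_measurable_mono) (auto simp: mono_def)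
  define K' where "K' y = ennreal (k (?F y))" for y
  have K' [measurable]: "K' \<in> borel_measurable borel" unfolding K'_def by simp
  have K'_le: "K' y \<le> 1" for y using k by (simp add: K'_def)
  have K'_eq: "(\<integral>\<^sup>+y. K' y * indicator {..x} y \<partial>?N) = ennreal (C (?F x) v)" for x
  proof -
    have "(\<integral>\<^sup>+y. K' y * indicator {..x} y \<partial>?N) = (\<integral>\<^sup>+y. ennreal (k (?F y)) * indicator {..?F x} (?F y) \<partial>?N)"
      using pos by (intro nn_integral_cong) (simp add: K'_def indicator_def)
    also have "\<dots> = (\<integral>\<^sup>+s. ennreal (k s) * indicator {..?F x} s \<partial>uniform_law)"
      unfolding distr_cdf_normal_law[OF pos, symmetric] by (subst nn_integral_distr) auto
    finally show ?thesis using k_eq[OF F01] by simp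
  qed
  have KK': "(\<integral>\<^sup>+y. K' y * indicator {..x} y \<partial>?N) = (\<integral>\<^sup>+y. K y * indicator {..x} y \<partial>?N)" for x
    unfolding K'_eq K_eq[symmetric] joint[symmetric] by (simp add: emeasure_eq_measure)
  \<comment> \<open>Finite measures agreeing on all half-lines \<open>{..x}\<close> coincide, so
    their densities agree almost everywhere.\<close>
  have "density ?N K = density ?N K'"
  proof (rule cdf_unique')
    have "finite_borel_measure (density ?N L)" if "L \<in> borel_measurable borel" "\<And>y. L y \<le> 1" for L
      using that N.finite_measure_density_le_1[of L]
      by (simp add: finite_borel_measure_def finite_borel_measure_axioms_def)
    then show "finite_borel_measure (density ?N K)" "finite_borel_measure (density ?N K')"
      using K K_le K' K'_le by auto
    show "cdf (density ?N K) = cdf (density ?N K')"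
      using KK' by (simp add: fun_eq_iff cdf_def measure_def emeasure_density)
  qed
  then have AE: "AE y in ?N. K y = K' y"
    by (intro N.density_unique) simp_all
  \<comment> \<open>The name refers to the upper process, whose kernel is the smaller one. Lowering
    the margin value \<open>v\<close> to that of the noisy process and then the copula to the
    Gaussian one can only decrease the value.\<close>
  have upper: "(\<integral>\<^sup>+y. emeasure (normal_law 1) {e. y + \<sigma> * e \<le> t} * indicator {..x} y \<partial>?N) \<le>
      (\<integral>\<^sup>+y. K' y * indicator {..x} y \<partial>?N)" for x
    unfolding K'_eq gaussian_copula_normal_cdf[OF pos \<sigma>, symmetric]
    using order_trans[OF gaussian_copula_mono[OF v_ge] lo] by (rule ennreal_leI)
  have lower: "(\<integral>\<^sup>+y. K' y * indicator {..x} y \<partial>?N) \<le> (\<integral>\<^sup>+y. indicator {..t} y * indicator {..x} y \<partial>?N)" for x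
  proof -
    have "measure M {\<omega> \<in> space M. X n \<omega> \<le> x \<and> Y \<omega> \<le> t} \<le> measure M {\<omega> \<in> space M. X n \<omega> \<le> x}"
      by (intro finite_measure_mono) auto
    also have "\<dots> = cdf (distr M borel (X n)) x"
      by (auto simp: cdf_def measure_distr intro!: arg_cong[where f = "measure M"])
    finally have 1: "C (?F x) v \<le> ?F x" using joint by (simp add: distr_X[OF n])
    have "measure M {\<omega> \<in> space M. X n \<omega> \<le> x \<and> Y \<omega> \<le> t} \<le> measure M {\<omega> \<in> space M. Y \<omega> \<le> t}"
      by (intro finite_measure_mono) auto
    also have "\<dots> = v"
      unfolding v_def by (auto simp: cdf_def measure_distr intro!: arg_cong[where f = "measure M"])
    finally have "C (?F x) v \<le> ?F t" using joint v_le by simp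
    \<comment> \<open>The joint probability is at most each marginal one, and
      \<open>v \<le> ?F t\<close> by the assumption on the margin. The resulting bound is the mass
      of \<open>{..t} \<inter> {..x}\<close>, which belongs to the noiseless kernel.\<close>
    with 1 have "C (?F x) v \<le> ?F (min x t)" by (simp add: min_def)
    also have "ennreal (?F (min x t)) = emeasure ?N ({..t} \<inter> {..x})"
      by (simp add: cdf_def N.emeasure_eq_measure Int_atMost min.commute)
    also have "\<dots> = (\<integral>\<^sup>+y. indicator {..t} y * indicator {..x} y \<partial>?N)"
      by (simp add: indicator_inter_arith[symmetric])
    finally show ?thesis unfolding K'_eq by (simp add: ennreal_leI)
  qed
  have "antimono K'"
    unfolding K'_def by (intro antimonoI ennreal_leI antimonoD[OF \<open>antimono k\<close>] N.cdf_nondecreasing)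
  then show ?thesis using K' K'_le AE upper lower by blast
qed

section \<open>Comparison of the three maxima\<close>

theorem theorem5p4:
  fixes M :: "'a measure"
    and \<xi> \<epsilon> X X_lower X_upper Xs :: "nat \<Rightarrow> 'a \<Rightarrow> real"
    and \<sigma> :: "nat \<Rightarrow> real"
    and C :: "nat \<Rightarrow> real \<Rightarrow> real \<Rightarrow> real"
    and d :: nat
  assumes "prob_space M"
    and "iid M (normal_law 1) \<xi> {1..}"
    and "\<And>n \<omega>. X n \<omega> = (\<Sum>i=1..n. \<xi> i \<omega>)"
    and "\<And>n. n \<ge> 1 \<Longrightarrow> \<sigma> n > 0"
    and "\<sigma> 0 = 0"
    and "iid M (normal_law 1) \<epsilon> UNIV"
    and "prob_space.indep_var M
           (Pi\<^sub>M UNIV (\<lambda>_. borel)) (\<lambda>\<omega> n. X n \<omega>)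
           (Pi\<^sub>M UNIV (\<lambda>_. borel)) (\<lambda>\<omega> n. \<epsilon> n \<omega>)"
    and "\<And>n \<omega>. X_lower n \<omega> = X n \<omega>"
    and "\<And>n \<omega>. X_upper n \<omega> = X n \<omega> + \<sigma> n * \<epsilon> n \<omega>"
    and "hidden_markov_model M X Xs"
    and "AE \<omega> in M. Xs 0 \<omega> = 0"
    and "\<And>n. n \<ge> 1 \<Longrightarrow> cdf (distr M borel (Xs n)) \<in> F_class n (\<sigma> n)"
    and "\<And>n. n \<ge> 1 \<Longrightarrow> copula_of M (X n) (Xs n) (C n)"
    and "\<And>n. n \<ge> 1 \<Longrightarrow> C n \<in> C_class n (\<sigma> n)"
    and "d \<ge> 1"
  shows "st_le M (\<lambda>\<omega>. MAX n\<in>{0..d}. X_lower n \<omega>) (\<lambda>\<omega>. MAX n\<in>{0..d}. Xs n \<omega>) \<and>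
         st_le M (\<lambda>\<omega>. MAX n\<in>{0..d}. Xs n \<omega>) (\<lambda>\<omega>. MAX n\<in>{0..d}. X_upper n \<omega>)"
proof -
  interpret gaussian_walk M \<xi> X
    using assms(1-3) by (simp add: gaussian_walk_def gaussian_walk_axioms_def)
  interpret N: prob_space "normal_law 1" by (simp add: prob_space_normal_law)
  interpret U: real_distribution uniform_law by (rule real_distribution_uniform_law)
  have X0: "X 0 \<omega> = 0" for \<omega> by (simp add: X_eq)
  have \<sigma>_nonneg: "0 \<le> \<sigma> n" for n using assms(4)[of n] assms(5) by (cases n) auto
  have [measurable]: "Xs n \<in> borel_measurable M" for n
    using assms(10) by (simp add: hidden_markov_model_def)
  have [measurable]: "\<epsilon> n \<in> borel_measurable M" for n
    using assms(6) by (simp add: iid_def indep_vars_def2)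
  have lower_eq: "X_lower = X" and upper_eq: "X_upper = (\<lambda>n \<omega>. X n \<omega> + \<sigma> n * \<epsilon> n \<omega>)"
    by (simp_all add: fun_eq_iff assms(8,9))
  obtain fs where fs_m: "\<forall>n. fs n \<in> borel_measurable borel" and
    fs_obs: "\<forall>J A t. finite J \<longrightarrow> J \<noteq> {} \<longrightarrow> (\<forall>n\<in>J. A n \<in> sets borel) \<longrightarrow>
      emeasure M {\<omega> \<in> space M. \<forall>n\<in>J. X n \<omega> \<in> A n \<and> Xs n \<omega> \<le> t} =
      (\<integral>\<^sup>+\<omega>. (\<Prod>n\<in>J. emeasure uniform_law {e. fs n (X n \<omega>, e) \<le> t} * indicator (A n) (X n \<omega>)) \<partial>M)"
    using hidden_markov_observations[OF assms(10) X0] by (elim exE conjE) (rule that)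
  note obs = fs_obs[rule_format]
  have fs [measurable]: "fs n \<in> borel_measurable borel" for n using fs_m by (rule spec)
  have le: "emeasure M {\<omega> \<in> space M. \<forall>n\<in>{1..d}. X_upper n \<omega> \<le> t} \<le> emeasure M {\<omega> \<in> space M. \<forall>n\<in>{1..d}. Xs n \<omega> \<le> t} \<and>
      emeasure M {\<omega> \<in> space M. \<forall>n\<in>{1..d}. Xs n \<omega> \<le> t} \<le> emeasure M {\<omega> \<in> space M. \<forall>n\<in>{1..d}. X_lower n \<omega> \<le> t}"
    if t: "0 \<le> t" for t
  proof -
    \<comment> \<open>For the fixed level \<open>t\<close>, these three kernels are the conditional
      probabilities, given \<open>X n = y\<close>, that the model, the noisy and the noiseless
      observation at time \<open>n\<close> are at most \<open>t\<close>.\<close>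
    define K where "K n y = emeasure uniform_law {e. fs n (y, e) \<le> t}" for n y
    define L_upper where "L_upper n y = emeasure (normal_law 1) {e. y + \<sigma> n * e \<le> t}" for n y
    define L_lower where "L_lower n y = (indicator {..t} y :: ennreal)" for n :: nat and y
    have K [measurable]: "K n \<in> borel_measurable borel" for n
    proof -
      have eq: "sets (borel \<Otimes>\<^sub>M uniform_law) = sets (borel :: (real \<times> real) measure)"
        unfolding borel_prod[symmetric] by (rule sets_pair_measure_cong) simp_all
      have "{p. fs n p \<le> t} \<in> sets (borel \<Otimes>\<^sub>M uniform_law)"
        unfolding eq using measurable_sets[OF fs[of n], of "{..t}"] by (simp add: vimage_def)
      from U.measurable_emeasure_Pair[OF this] show ?thesis unfolding K_def vimage_def by simp
    qed
    define kernel where "kernel n K' \<longleftrightarrow> K' \<in> borel_measurable borel \<and> antimono K' \<and> (\<forall>y. K' y \<le> (1 :: ennreal)) \<and>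
        (1 \<le> n \<longrightarrow> (AE y in normal_law n. K n y = K' y) \<and>
        (\<forall>x. (\<integral>\<^sup>+y. L_upper n y * indicator {..x} y \<partial>normal_law n) \<le> (\<integral>\<^sup>+y. K' y * indicator {..x} y \<partial>normal_law n)) \<and>
        (\<forall>x. (\<integral>\<^sup>+y. K' y * indicator {..x} y \<partial>normal_law n) \<le> (\<integral>\<^sup>+y. L_lower n y * indicator {..x} y \<partial>normal_law n)))"
      for n K'
    have "\<exists>K'. kernel n K'" for n
    proof (cases "1 \<le> n")
      case True
      \<comment> \<open>The observation formula at the single time \<open>n\<close>, restricted to
        the half-line \<open>{..x}\<close>, links the kernel to the joint law of \<open>X n\<close>
        and \<open>Xs n\<close>, on which the copula assumption bears.\<close>
      have "emeasure M {\<omega> \<in> space M. X n \<omega> \<le> x \<and> Xs n \<omega> \<le> t} = (\<integral>\<^sup>+y. K n y * indicator {..x} y \<partial>normal_law n)" for x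
        using obs[of "{n}" "\<lambda>_. {..x}" t] nn_integral_X[OF True, of "\<lambda>y. K n y * indicator {..x} y"]
        by (simp add: K_def[symmetric])
      moreover have "K n y \<le> 1" for y using U.emeasure_le_1 by (simp add: K_def)
      ultimately show ?thesis
        using observation_kernel_bounds[OF True assms(4)[OF True] t _ assms(12)[OF True] assms(13)[OF True] assms(14)[OF True], of "K n"]
        unfolding kernel_def L_upper_def L_lower_def by auto
    next
      case False
      \<comment> \<open>Time 0 does not occur in the products; the constant 1 is a default meeting
        the regularity conditions that the exchange lemma states for all \<open>n\<close>.\<close>
      then have "kernel n (\<lambda>_. 1)" by (auto simp: kernel_def monotone_on_def)
      then show ?thesis by (rule exI[of "kernel n"])
    qed
    then obtain K' where kernel: "\<And>n. kernel n (K' n)" by metis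
    have K' [measurable]: "K' n \<in> borel_measurable borel"
      and anti: "antimono (K' n)" and K'_le: "K' n y \<le> 1" for n y
      using kernel[of n] by (simp_all add: kernel_def)
    have K'_eq: "AE y in normal_law n. K n y = K' n y"
      and upper: "(\<integral>\<^sup>+y. L_upper n y * indicator {..x} y \<partial>normal_law n) \<le> (\<integral>\<^sup>+y. K' n y * indicator {..x} y \<partial>normal_law n)"
      and lower: "(\<integral>\<^sup>+y. K' n y * indicator {..x} y \<partial>normal_law n) \<le> (\<integral>\<^sup>+y. L_lower n y * indicator {..x} y \<partial>normal_law n)"
      if "1 \<le> n" for n x
      using kernel[of n] that by (simp_all add: kernel_def)
    have L_upper [measurable]: "L_upper n \<in> borel_measurable borel" for n
      unfolding L_upper_def by measurable
    have L_lower [measurable]: "L_lower n \<in> borel_measurable borel" for n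
      unfolding L_lower_def by measurable
    have L_upper_le: "L_upper n y \<le> 1" and L_lower_le: "L_lower n y \<le> 1" for n y
      using N.emeasure_le_1 by (auto simp: L_upper_def L_lower_def indicator_def)
    have L_lower_anti: "antimono (L_lower n)" for n
      by (auto simp: L_lower_def indicator_def intro!: antimonoI)
    have L_upper_anti: "antimono (L_upper n)" for n
      unfolding L_upper_def by (intro antimonoI emeasure_mono) auto
    have J: "{1..d} \<noteq> {}" using assms(15) by simp
    have "emeasure M {\<omega> \<in> space M. \<forall>n\<in>{1..d}. Xs n \<omega> \<le> t} = (\<integral>\<^sup>+\<omega>. (\<Prod>n=1..d. K n (X n \<omega>)) \<partial>M)"
      using obs[of "{1..d}" "\<lambda>_. UNIV" t] J by (simp add: K_def)
    also have "\<dots> = (\<integral>\<^sup>+\<omega>. (\<Prod>n=1..d. K' n (X n \<omega>)) \<partial>M)"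
    proof (rule nn_integral_cong_AE)
      have "AE \<omega> in M. K n (X n \<omega>) = K' n (X n \<omega>)" if "1 \<le> n" for n
        using K'_eq[OF that] unfolding distr_X[OF that, symmetric] by (subst (asm) AE_distr_iff) auto
      then have "AE \<omega> in M. \<forall>n\<in>{1..d}. K n (X n \<omega>) = K' n (X n \<omega>)"
        by (intro AE_finite_allI) auto
      then show "AE \<omega> in M. (\<Prod>n=1..d. K n (X n \<omega>)) = (\<Prod>n=1..d. K' n (X n \<omega>))"
        by eventually_elim (auto intro!: prod.cong)
    qed
    finally have Xs_prob: "emeasure M {\<omega> \<in> space M. \<forall>n\<in>{1..d}. Xs n \<omega> \<le> t} = (\<integral>\<^sup>+\<omega>. (\<Prod>n=1..d. K' n (X n \<omega>)) \<partial>M)" .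
    have lower_prob: "emeasure M {\<omega> \<in> space M. \<forall>n\<in>{1..d}. X_lower n \<omega> \<le> t} = (\<integral>\<^sup>+\<omega>. (\<Prod>n=1..d. L_lower n (X n \<omega>)) \<partial>M)"
    proof -
      have "emeasure M {\<omega> \<in> space M. \<forall>n\<in>{1..d}. X n \<omega> \<le> t} =
          (\<integral>\<^sup>+\<omega>. indicator {\<omega> \<in> space M. \<forall>n\<in>{1..d}. X n \<omega> \<le> t} \<omega> \<partial>M)"
        by simp
      also have "\<dots> = (\<integral>\<^sup>+\<omega>. (\<Prod>n=1..d. L_lower n (X n \<omega>)) \<partial>M)"
        by (intro nn_integral_cong) (auto simp: L_lower_def indicator_def prod_zero_iff)
      finally show ?thesis by (simp add: lower_eq)
    qed
    have upper_prob: "emeasure M {\<omega> \<in> space M. \<forall>n\<in>{1..d}. X_upper n \<omega> \<le> t} = (\<integral>\<^sup>+\<omega>. (\<Prod>n=1..d. L_upper n (X n \<omega>)) \<partial>M)"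
    proof -
      \<comment> \<open>Independence of the whole sequences is restricted to the finitely many
        noises in play; the full path of \<open>X\<close> serves as the hidden data.\<close>
      have "(\<lambda>v. restrict v {1..d}) \<in> measurable (Pi\<^sub>M UNIV (\<lambda>_. borel)) (Pi\<^sub>M {1..d} (\<lambda>_. borel :: real measure))"
        by (rule measurable_restrict_subset) simp
      from indep_var_compose[OF assms(7) measurable_ident this]
      have ind: "indep_var (Pi\<^sub>M UNIV (\<lambda>_. borel)) (\<lambda>\<omega> n. X n \<omega>) (Pi\<^sub>M {1..d} (\<lambda>_. borel)) (\<lambda>\<omega>. \<lambda>n\<in>{1..d}. \<epsilon> n \<omega>)"
        by (simp add: comp_def id_def)
      have "iid M (normal_law 1) \<epsilon> {1..d}"
        using assms(6) indep_vars_subset[of "\<lambda>_. borel" \<epsilon> UNIV "{1..d}"] by (auto simp: iid_def)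
      from emeasure_noisy_observations[OF ind this _ J, of "\<lambda>n w. w n" "\<lambda>n. {p. fst p + \<sigma> n * snd p \<le> t}"]
      show ?thesis
        by (simp add: upper_eq L_upper_def borel_closed closed_Collect_le continuous_intros)
    qed
    show ?thesis
      unfolding Xs_prob lower_prob upper_prob
      by (intro conjI nn_integral_prod_le L_upper L_lower K' L_upper_anti L_lower_anti anti
        L_upper_le L_lower_le K'_le upper lower)
  qed
  show ?thesis
  proof
    show "st_le M (\<lambda>\<omega>. MAX n\<in>{0..d}. X_lower n \<omega>) (\<lambda>\<omega>. MAX n\<in>{0..d}. Xs n \<omega>)"
      by (rule st_le_MaxI) (use le assms(1,11) X0 in \<open>simp_all add: lower_eq\<close>)
    \<comment> \<open>The convention \<open>\<sigma> 0 = 0\<close> makes the noisy process start at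
      0, as \<open>st_le_MaxI\<close> requires.\<close>
    show "st_le M (\<lambda>\<omega>. MAX n\<in>{0..d}. Xs n \<omega>) (\<lambda>\<omega>. MAX n\<in>{0..d}. X_upper n \<omega>)"
      by (rule st_le_MaxI) (use le assms(1,5,11) X0 in \<open>simp_all add: upper_eq\<close>)
  qed
qed

end
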